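(* Let $1<p<\infty$, $0<\theta<1$, $1\le r<\infty$. Then $\bigl(L^{p)}(\Omega),L^{(p}(\Omega)\bigr)_{\theta,r}$ coincides with the set of measurable $f$ on $\Omega$ for which $$\rho(f)=\Bigl[\int_0^1 (1-\log t)^{\theta r-1}\Bigl(\int_0^t(1-\log x)^{-1}f_*^p(x)\,dx\Bigr)^{r/p}\frac{dt}{t}\Bigr]^{1/r}<\infty,$$ and $\|f\|_{(L^{p)},L^{(p})_{\theta,r}}\approx\rho(f)$ with constants independent of $f$. In other words, $(L^{p)},L^{(p})_{\theta,r}=G\Gamma(p,r;w_1,w_2)$ with $w_1(t)=t^{-1}(1-\log t)^{\theta r-1}$ and $w_2(t)=(1-\log t)^{-1}$, $t\in(0,1)$.
   Context: $\Omega\subset\mathbb R^n$ is a bounded open set with $|\Omega|=1$; $f_*$ is the decreasing rearrangement of $|f|$ on $(0,1)$; $\log$ is the natural logarithm. Grand Lebesgue space $L^{p)}(\Omega)$ ($1<p<\infty$): measurable $f$ with $\|f\|_{p)}=\sup_{0<t<1}(1-\log t)^{-1/p}(\int_t^1 f_*^p)^{1/p}<\infty$. Small Lebesgue space $L^{(p}(\Omega)$ ($1<p<\infty$): measurable $f$ with $\|f\|_{(p}=\int_0^1(1-\log t)^{-1/p}(\int_0^t f_*^p)^{1/p}\frac{dt}{t}<\infty$. Generalized Gamma space with double weights: for weights $w_1,w_2$ on $(0,1)$, $1\le m<\infty$, $1\le p<\infty$, $G\Gamma(p,m;w_1,w_2)$ is the set of measurable $v$ on $\Omega$ with $\bigl[\int_0^1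 w_1(t)\bigl(\int_0^t v_*^p(\sigma)w_2(\sigma)d\sigma\bigr)^{m/p}dt\bigr]^{1/m}<\infty$. K-functional: $K(g,t;X_0,X_1)=\inf_{g=g_0+g_1}(\|g_0\|_{X_0}+t\|g_1\|_{X_1})$; $(X_0,X_1)_{\theta,r}$ is the set of $g\in X_0+X_1$ with $\|g\|_{\theta,r}=\bigl(\int_0^1[t^{-\theta}K(g,t)]^r\frac{dt}{t}\bigr)^{1/r}<\infty$ (only $t\in(0,1)$ used). *)

theory Defs
  imports "HOL-Analysis.Analysis"
begin

text \<open>Real powers of extended nonnegative reals (used only with positive exponents).\<close>
definition epow :: "ennreal \<Rightarrow> real \<Rightarrow> ennreal" where
  "epow x a = (if x = top then top else ennreal (enn2real x powr a))"

definition meas_on :: "'a::euclidean_space set \<Rightarrow> ('a \<Rightarrow> real) \<Rightarrow> bool" where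
  "meas_on \<Omega> f \<longleftrightarrow> f \<in> borel_measurable (restrict_space lebesgue \<Omega>)"

definition distr_fun :: "'a::euclidean_space set \<Rightarrow> ('a \<Rightarrow> real) \<Rightarrow> real \<Rightarrow> ennreal" where
  "distr_fun \<Omega> f s = emeasure lebesgue {x\<in>\<Omega>. s < \<bar>f x\<bar>}"

definition drearr :: "'a::euclidean_space set \<Rightarrow> ('a \<Rightarrow> real) \<Rightarrow> real \<Rightarrow> real" where
  "drearr \<Omega> f t = Inf {s::real. 0 \<le> s \<and> distr_fun \<Omega> f s \<le> ennreal t}"

definition grand_norm :: "'a::euclidean_space set \<Rightarrow> real \<Rightarrow> ('a \<Rightarrow> real) \<Rightarrow> ennreal" where
  "grand_norm \<Omega> p f = (SUP t\<in>{0<..<1}. ennreal ((1 - ln t) powr (- 1 / p)) *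
      epow (\<integral>\<^sup>+ x. indicator {t..1} x * ennreal (drearr \<Omega> f x powr p) \<partial>lborel) (1 / p))"

definition small_norm :: "'a::euclidean_space set \<Rightarrow> real \<Rightarrow> ('a \<Rightarrow> real) \<Rightarrow> ennreal" where
  "small_norm \<Omega> p f = (\<integral>\<^sup>+ t. indicator {0<..<1} t * ennreal ((1 - ln t) powr (- 1 / p) / t) *
      epow (\<integral>\<^sup>+ x. indicator {0..t} x * ennreal (drearr \<Omega> f x powr p) \<partial>lborel) (1 / p) \<partial>lborel)"

definition grand_space :: "'a::euclidean_space set \<Rightarrow> real \<Rightarrow> ('a \<Rightarrow> real) set" where
  "grand_space \<Omega> p = {f. meas_on \<Omega> f \<and> grand_norm \<Omega> p f < top}"

definition small_space :: "'a::euclidean_space set \<Rightarrow> real \<Rightarrow> ('a \<Rightarrow> real) set" where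
  "small_space \<Omega> p = {f. meas_on \<Omega> f \<and> small_norm \<Omega> p f < top}"

definition Kfun :: "'a::euclidean_space set \<Rightarrow> real \<Rightarrow> ('a \<Rightarrow> real) \<Rightarrow> real \<Rightarrow> ennreal" where
  "Kfun \<Omega> p g t = (INF gg \<in> {(g0, g1). g0 \<in> grand_space \<Omega> p \<and> g1 \<in> small_space \<Omega> p \<and>
        (\<forall>x\<in>\<Omega>. g x = g0 x + g1 x)}.
      grand_norm \<Omega> p (fst gg) + ennreal t * small_norm \<Omega> p (snd gg))"

definition sum_space :: "'a::euclidean_space set \<Rightarrow> real \<Rightarrow> ('a \<Rightarrow> real) set" where
  "sum_space \<Omega> p = {g. meas_on \<Omega> g \<and> (\<exists>g0 g1. g0 \<in> grand_space \<Omega> p \<and> g1 \<in> small_space \<Omega> p \<and>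
        (\<forall>x\<in>\<Omega>. g x = g0 x + g1 x))}"

definition interp_norm :: "'a::euclidean_space set \<Rightarrow> real \<Rightarrow> real \<Rightarrow> real \<Rightarrow> ('a \<Rightarrow> real) \<Rightarrow> ennreal" where
  "interp_norm \<Omega> p \<theta> r g = epow (\<integral>\<^sup>+ t. indicator {0<..<1} t *
      epow (ennreal (t powr (- \<theta>)) * Kfun \<Omega> p g t) r * ennreal (1 / t) \<partial>lborel) (1 / r)"

definition interp_space :: "'a::euclidean_space set \<Rightarrow> real \<Rightarrow> real \<Rightarrow> real \<Rightarrow> ('a \<Rightarrow> real) set" where
  "interp_space \<Omega> p \<theta> r = {g. g \<in> sum_space \<Omega> p \<and> interp_norm \<Omega> p \<theta> r g < top}"

definition ggamma_norm :: "'a::euclidean_space set \<Rightarrow> real \<Rightarrow> real \<Rightarrow> (real \<Rightarrow> real) \<Rightarrow> (real \<Rightarrow> real)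
    \<Rightarrow> ('a \<Rightarrow> real) \<Rightarrow> ennreal" where
  "ggamma_norm \<Omega> p m w1 w2 v = epow (\<integral>\<^sup>+ t. indicator {0<..<1} t * ennreal (w1 t) *
      epow (\<integral>\<^sup>+ \<sigma>. indicator {0..t} \<sigma> * ennreal (drearr \<Omega> v \<sigma> powr p * w2 \<sigma>) \<partial>lborel) (m / p)
      \<partial>lborel) (1 / m)"

definition ggamma_space :: "'a::euclidean_space set \<Rightarrow> real \<Rightarrow> real \<Rightarrow> (real \<Rightarrow> real) \<Rightarrow> (real \<Rightarrow> real)
    \<Rightarrow> ('a \<Rightarrow> real) set" where
  "ggamma_space \<Omega> p m w1 w2 = {v. meas_on \<Omega> v \<and> ggamma_norm \<Omega> p m w1 w2 v < top}"

end

theory Submission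
  imports Defs
begin

text \<open>
  Cut $(0,1)$ at the points $t_k = e^{1-2^k}$, where $1 - \log t$ equals $2^k$, and put
  $h_k = \bigl(\int_0^{t_k} (1-\log x)^{-1} f_*^p(x)\,dx\bigr)^{1/p}$. On the $k$-th block the weights are
  constant up to a factor, so the grand norm behaves like a weighted $\ell^\infty$ norm and the small
  norm like a weighted $\ell^1$ norm of the block norms of $f_*$, with weight ratio $2^k$. Truncating
  $f$ at the level $f_*(t_m)$ gives $K(f,2^{-m}) \lesssim \sum_{k\le m} 2^{k-m} h_k$. Conversely,
  $f_*(x) \le u_*(x/2) + v_*(x/2)$ for every decomposition $f = u + v$, which bounds the contribution
  of the $m$-th block to $h_m$ by $K(f,2^{-m})$. A discrete Hardy inequality turns both estimates into
  the equivalence of $\sum_m 2^{m\theta r} K(f,2^{-m})^r$ and $\sum_m 2^{m\theta r} h_m^r$, and these two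
  series are equivalent to the integrals defining the interpolation norm and $\rho(f)$.
\<close>

section \<open>Powers of extended reals and a discrete Hardy inequality\<close>

text \<open>Apart from the measure dt/t, the weights see \<open>t\<close> only through
  \<open>1 - ln t\<close>. Blocks are therefore cut where this quantity doubles, not where
  \<open>t\<close> halves. A block has mass \<open>2 ^ k\<close> for dt/t, which turns the exponent
  \<open>\<theta> * r - 1\<close> of the outer weight into \<open>\<theta> * r\<close> in the
  series. The rearrangement is not subadditive at a fixed point, and the substitute costs a dilation
  by 2; this is harmless because consecutive cut points differ by a factor of at least 2, so the
  dilation shifts by at most one block. Each end of 0 < \<theta> < 1 serves one direction: \<theta>
  < 1 makes the kernel of the truncation estimate decay, \<theta> > 0 makes the sum over the blocks
  beyond \<open>m\<close> decay. Finally, the decomposition estimate bounds only blocks of index at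
  least 1, so the block from 1/e to 1 is out of its reach and is controlled by monotonicity
  instead.\<close>

lemma epow_ennreal: "0 \<le> x \<Longrightarrow> epow (ennreal x) a = ennreal (x powr a)"
  by (simp add: epow_def)

lemma epow_0 [simp]: "epow 0 a = 0"
  by (simp add: epow_def)

lemma epow_top [simp]: "epow top a = top"
  by (simp add: epow_def)

lemma epow_one [simp]: "epow x 1 = x"
  by (cases x) (auto simp: epow_def)

lemma epow_less_top_iff: "epow x a < top \<longleftrightarrow> x < top"
  by (auto simp: epow_def top.not_eq_extremum)

lemma epow_mono: "0 \<le> a \<Longrightarrow> x \<le> y \<Longrightarrow> epow x a \<le> epow y a"
  by (cases x; cases y) (auto simp: epow_ennreal powr_mono2 top_unique)

lemma epow_mult:
  assumes "0 < a" shows "epow (x * y) a = epow x a * epow y a"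
proof -
  \<comment> \<open>The mixed cases rest on \<open>0 * top = 0\<close>, which \<open>epow\<close>
    respects because it fixes both \<open>0\<close> and \<open>top\<close>.\<close>
  have "epow (top * ennreal y) a = top * epow (ennreal y) a"
       "epow (ennreal y * top) a = epow (ennreal y) a * top" if "0 \<le> y" for y
    using that by (cases "y = 0"; simp add: ennreal_top_mult ennreal_mult_top epow_ennreal)+
  then show ?thesis
    by (cases x; cases y) (auto simp: epow_ennreal powr_mult simp flip: ennreal_mult)
qed

lemma epow_epow: "0 < a \<Longrightarrow> epow (epow x a) b = epow x (a * b)"
  by (cases x) (auto simp: epow_ennreal powr_powr)

lemma suminf_ennreal_swap:
  fixes f :: "nat \<Rightarrow> nat \<Rightarrow> ennreal"
  shows "(\<Sum>m. \<Sum>k. f m k) = (\<Sum>k. \<Sum>m. f m k)"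
  using nn_integral_suminf[of "\<lambda>m k. f m k" "count_space UNIV"]
  by (simp add: nn_integral_count_space_nat)

text \<open>Splitting at \<open>k = m\<close> leaves two one-sided geometric sums, each at most
  \<open>1 / (1 - q)\<close>. What matters is that the bound does not depend on \<open>m\<close>:
  the kernel is symmetric, so it bounds row sums and column sums alike.\<close>

lemma suminf_geometric_dist_le:
  fixes q :: real
  assumes "0 < q" "q < 1"
  shows "(\<Sum>k. ennreal (q ^ ((m - k) + (k - m)))) \<le> ennreal (2 / (1 - q))"
proof -
  have geo: "(\<Sum>k. ennreal (q ^ k)) = ennreal (1 / (1 - q))"
    using assms by (intro suminf_ennreal_eq geometric_sums) auto
  have "(\<Sum>k. ennreal (q ^ ((m - k) + (k - m)))) =
      (\<Sum>k. ennreal (q ^ ((m - (k + m)) + ((k + m) - m)))) + (\<Sum>k<m. ennreal (q ^ ((m - k) + (k - m))))"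
    by (rule suminf_offset) simp
  also have "(\<Sum>k. ennreal (q ^ ((m - (k + m)) + ((k + m) - m)))) = ennreal (1 / (1 - q))"
    using geo by simp
  \<comment> \<open>For \<open>k < m\<close> the distance \<open>m - k\<close> runs through 1, ...,
    m; reversing the order gives the exponents \<open>Suc k\<close>.\<close>
  also have "(\<Sum>k<m. ennreal (q ^ ((m - k) + (k - m)))) = (\<Sum>k<m. ennreal (q ^ Suc k))"
    by (rule sum.reindex_bij_witness[of _ "\<lambda>k. m - Suc k" "\<lambda>k. m - Suc k"])
      (auto simp: Suc_diff_Suc simp flip: power_Suc)
  also have "\<dots> \<le> (\<Sum>k<m. ennreal (q ^ k))"
    using assms by (intro sum_mono ennreal_leI power_decreasing) auto
  also have "\<dots> \<le> ennreal (1 / (1 - q))"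
    unfolding geo[symmetric] by (rule sum_le_suminf) auto
  also have "ennreal (1 / (1 - q)) + ennreal (1 / (1 - q)) = ennreal (2 / (1 - q))"
    using assms by (simp flip: ennreal_plus)
  finally show ?thesis by (simp add: add_left_mono)
qed

text \<open>
  Writing \<open>q = w\<^sup>2\<close>, one factor \<open>w\<close> makes the inner sum converge after the other has been absorbed into
  the supremum of \<open>w ^ \<bar>m - k\<bar> * X k\<close>, which is at most the corresponding \<open>l\<^sup>s\<close> sum; no
  convexity is used, so every \<open>s > 0\<close> is admitted. With truncated subtraction,
  \<open>(m - k) + (k - m)\<close> is \<open>\<bar>m - k\<bar>\<close>.
\<close>
lemma discrete_hardy:
  fixes q s :: real
  assumes q: "0 < q" "q < 1" and s: "0 < s"
  obtains C where "0 < C"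
    "\<And>X :: nat \<Rightarrow> ennreal. (\<Sum>m. epow (\<Sum>k. ennreal (q ^ ((m - k) + (k - m))) * X k) s)
        \<le> ennreal C * (\<Sum>k. epow (X k) s)"
proof -
  define w where "w = sqrt q"
  have w: "0 < w" "w < 1" "w * w = q" using q by (auto simp: w_def)
  have ws: "0 < w powr s" "w powr s < 1" using w s powr_less_mono2[of s w 1] by auto
  define A where "A = 2 / (1 - w)"
  define B where "B = 2 / (1 - w powr s)"
  have AB: "A > 0" "B > 0" using w ws by (auto simp: A_def B_def)
  define d where "d m k = (m - k) + (k - m)" for m k :: nat
  have dc: "d m k = d k m" for m k by (simp add: d_def)
  have "(\<Sum>m. epow (\<Sum>k. ennreal (q ^ d m k) * X k) s) \<le> ennreal (A powr s * B) * (\<Sum>k. epow (X k) s)"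
    for X :: "nat \<Rightarrow> ennreal"
  proof -
    define Y where "Y m k = ennreal (w ^ d m k) * X k" for m k
    define S where "S m = (\<Sum>k. epow (Y m k) s)" for m
    have Y_le: "Y m k \<le> epow (S m) (1 / s)" for m k
    proof -
      have "epow (Y m k) s \<le> S m"
        unfolding S_def using sum_le_suminf[of "\<lambda>k. epow (Y m k) s" "{k}"] by auto
      from epow_mono[OF _ this, of "1 / s"] show ?thesis
        using s by (simp add: epow_epow)
    qed
    have one: "epow (\<Sum>k. ennreal (q ^ d m k) * X k) s \<le> ennreal (A powr s) * S m" for m
    proof -
      have "ennreal (q ^ n) = ennreal (w ^ n) * ennreal (w ^ n)" for n
        using w(1) by (subst ennreal_mult[symmetric]) (auto simp: w(3)[symmetric] power_mult_distrib)
      then have "(\<Sum>k. ennreal (q ^ d m k) * X k) = (\<Sum>k. ennreal (w ^ d m k) * Y m k)"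
        unfolding Y_def by (simp add: mult.assoc)
      also have "\<dots> \<le> (\<Sum>k. ennreal (w ^ d m k) * epow (S m) (1 / s))"
        by (intro suminf_le mult_left_mono Y_le) auto
      also have "\<dots> \<le> ennreal A * epow (S m) (1 / s)"
        unfolding ennreal_suminf_multc A_def d_def
        by (intro mult_right_mono suminf_geometric_dist_le w) auto
      finally have "epow (\<Sum>k. ennreal (q ^ d m k) * X k) s \<le> epow (ennreal A * epow (S m) (1 / s)) s"
        using s by (intro epow_mono) auto
      also have "\<dots> = ennreal (A powr s) * S m"
        using s AB by (simp add: epow_mult epow_epow epow_ennreal)
      finally show ?thesis .
    qed
    have "epow (Y m k) s = ennreal ((w powr s) ^ d k m) * epow (X k) s" for m k
    proof -
      have "(w ^ n) powr s = (w powr s) ^ n" for n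
        using w(1) by (induction n) (auto simp: powr_mult)
      then have "(w ^ d k m) powr s = (w powr s) ^ d k m"
        by blast
      then show ?thesis
        using w(1) s dc[of m k] by (simp add: Y_def epow_mult epow_ennreal)
    qed
    \<comment> \<open>\<open>S m\<close> is again a kernel sum, now with ratio
      \<open>w powr s\<close> acting on the powers \<open>epow (X k) s\<close>. After the exchange
      of sums only its column sums remain, and these are geometric.\<close>
    then have "(\<Sum>m. S m) = (\<Sum>k. \<Sum>m. ennreal ((w powr s) ^ d k m) * epow (X k) s)"
      unfolding S_def by (subst suminf_ennreal_swap) simp
    also have "\<dots> \<le> (\<Sum>k. ennreal B * epow (X k) s)"
      unfolding ennreal_suminf_multc B_def d_def
      by (intro suminf_le mult_right_mono suminf_geometric_dist_le ws) auto
    finally have two: "(\<Sum>m. S m) \<le> ennreal B * (\<Sum>k. epow (X k) s)" by simp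
    have "(\<Sum>m. epow (\<Sum>k. ennreal (q ^ d m k) * X k) s) \<le> (\<Sum>m. ennreal (A powr s) * S m)"
      by (intro suminf_le one) auto
    also have "\<dots> \<le> ennreal (A powr s) * (ennreal B * (\<Sum>k. epow (X k) s))"
      using two by (simp add: mult_left_mono)
    finally show ?thesis using AB by (simp add: ennreal_mult mult.assoc)
  qed
  with AB show ?thesis using that[of "A powr s * B"] unfolding d_def by auto
qed

section \<open>Logarithmic blocks\<close>

definition tcut :: "nat \<Rightarrow> real" where
  "tcut k = exp (1 - 2 ^ k)"

lemma tcut_pos [simp]: "0 < tcut k"
  by (simp add: tcut_def)

lemma tcut_0 [simp]: "tcut 0 = 1"
  by (simp add: tcut_def)

lemma one_minus_ln_tcut [simp]: "1 - ln (tcut k) = 2 ^ k"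
  by (simp add: tcut_def)

text \<open>The quotient of consecutive cut points is \<open>exp (- (2 ^ k))\<close>, at most 1/e.
  Two later uses: a block fills at least half of \<open>{0..tcut k}\<close>, and halving a point
  moves it by at most one block.\<close>

lemma tcut_Suc_le_half: "tcut (Suc k) \<le> tcut k / 2"
proof -
  have "tcut (Suc k) = tcut k * exp (- (2 ^ k))"
    unfolding tcut_def exp_add[symmetric] by (rule arg_cong[where f = exp]) simp
  also have "exp (- (2 ^ k) :: real) \<le> exp (- 1)"
    by simp
  also have "exp (- 1 :: real) \<le> 1 / 2"
    using exp_ge_add_one_self[of 1] by (simp add: exp_minus field_simps)
  finally show ?thesis by (simp add: mult_left_mono)
qed

lemma tcut_Suc_le: "tcut (Suc k) \<le> tcut k"
  using tcut_Suc_le_half[of k] tcut_pos[of k] by linarith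

lemma tcut_antimono: "j \<le> k \<Longrightarrow> tcut k \<le> tcut j"
  by (simp add: tcut_def)

lemma tcut_le_1: "tcut k \<le> 1"
  using tcut_antimono[of 0 k] by simp

lemma tcut_less_1: "tcut (Suc k) < 1"
  using tcut_Suc_le_half[of k] tcut_le_1[of k] by linarith

lemma tcut_tendsto_0: "tcut \<longlonglongrightarrow> 0"
proof (rule tendsto_sandwich[of "\<lambda>_. 0" tcut _ "\<lambda>k. (1 / 2) ^ k"])
  have "tcut k \<le> (1 / 2) ^ k" for k
  proof (induction k)
    case (Suc k)
    then show ?case using tcut_Suc_le_half[of k] by simp
  qed simp
  then show "\<forall>\<^sub>F k in sequentially. tcut k \<le> (1 / 2) ^ k" by simp
  show "\<forall>\<^sub>F k in sequentially. 0 \<le> tcut k"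
    by (simp add: less_imp_le)
qed (auto intro!: LIMSEQ_realpow_zero)

lemma one_minus_ln_block:
  assumes "tcut (Suc k) \<le> t" "t \<le> tcut k"
  shows "2 ^ k \<le> 1 - ln t" "1 - ln t \<le> 2 ^ Suc k" "0 < t"
proof -
  show t: "0 < t" using assms(1) tcut_pos[of "Suc k"] by linarith
  have "ln t \<le> ln (tcut k)" using assms(2) t by simp
  then show "2 ^ k \<le> 1 - ln t" using one_minus_ln_tcut[of k] by linarith
  have "ln (tcut (Suc k)) \<le> ln t" using assms(1) t by (subst ln_le_cancel_iff) auto
  then show "1 - ln t \<le> 2 ^ Suc k" using one_minus_ln_tcut[of "Suc k"] by linarith
qed

text \<open>Half-open intervals make consecutive blocks disjoint; the closed interval of the
  fundamental theorem differs by one null point.\<close>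

lemma nn_integral_inverse_block:
  fixes a b :: real
  assumes "0 < a" "a \<le> b"
  shows "(\<integral>\<^sup>+t. indicator {a..<b} t * ennreal (1 / t) \<partial>lborel) = ennreal (ln b - ln a)"
proof -
  have "((\<lambda>t. 1 / t) has_integral (ln b - ln a)) {a..b}"
  proof (rule fundamental_theorem_of_calculus)
    show "(ln has_vector_derivative 1 / t) (at t within {a..b})" if "t \<in> {a..b}" for t
      using that assms
      by (auto intro!: derivative_eq_intros simp flip: has_real_derivative_iff_has_vector_derivative)
  qed fact
  then have "(\<integral>\<^sup>+t. ennreal (1 / t) * indicator {a..b} t \<partial>lborel) = ennreal (ln b - ln a)"
    using assms by (intro nn_integral_has_integral_lebesgue') auto
  also have "(\<integral>\<^sup>+t. ennreal (1 / t) * indicator {a..b} t \<partial>lborel) =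
      (\<integral>\<^sup>+t. indicator {a..<b} t * ennreal (1 / t) \<partial>lborel)"
    using AE_lborel_singleton[of b]
    by (intro nn_integral_cong_AE, elim eventually_mono) (auto simp: indicator_def)
  finally show ?thesis .
qed

lemma block_cover:
  fixes a :: "nat \<Rightarrow> real"
  assumes "a \<longlonglongrightarrow> 0" "0 < t" "t < a 0"
  obtains m where "a (Suc m) \<le> t" "t < a m"
proof -
  have "\<forall>\<^sub>F k in sequentially. a k < t"
    using assms by (simp add: order_tendsto_iff)
  then have "\<exists>k. a k \<le> t"
    by (auto simp: eventually_sequentially intro: less_imp_le)
  define n where "n = (LEAST k. a k \<le> t)"
  have "a n \<le> t" unfolding n_def by (rule LeastI_ex) fact
  moreover from this assms obtain m where m: "n = Suc m" by (cases n) auto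
  moreover have "\<not> a m \<le> t" using not_less_Least[of m "\<lambda>k. a k \<le> t"] m n_def by auto
  ultimately show ?thesis using that[of m] by auto
qed

text \<open>The integrand is dominated by a step function times 1/t, and only this majorant is
  integrated term by term; \<open>g\<close> enters through monotonicity alone, so it may be the
  integrand with the K-functional. The cut points are left general because both \<open>tcut\<close>
  and the powers of 1/2 are used.\<close>

lemma nn_integral_blocks_le:
  fixes a :: "nat \<Rightarrow> real" and g :: "real \<Rightarrow> ennreal"
  assumes a: "a 0 = 1" "\<And>m. 0 < a m" "decseq a" "a \<longlonglongrightarrow> 0"
    and g: "\<And>m t. a (Suc m) \<le> t \<Longrightarrow> t < a m \<Longrightarrow> g t \<le> d m * ennreal (1 / t)"
  shows "(\<integral>\<^sup>+t. indicator {0<..<1} t * g t \<partial>lborel) \<le> (\<Sum>m. d m * ennreal (ln (a m) - ln (a (Suc m))))"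
proof -
  have "indicator {0<..<1} t * g t \<le> (\<Sum>m. d m * (indicator {a (Suc m)..<a m} t * ennreal (1 / t)))" for t
  proof (cases "t \<in> {0<..<1}")
    case True
    then obtain m where m: "a (Suc m) \<le> t" "t < a m"
      using block_cover[OF a(4), of t] a(1) by auto
    then have "g t \<le> (\<Sum>m\<in>{m}. d m * (indicator {a (Suc m)..<a m} t * ennreal (1 / t)))"
      using g by simp
    also have "\<dots> \<le> (\<Sum>m. d m * (indicator {a (Suc m)..<a m} t * ennreal (1 / t)))"
      by (rule sum_le_suminf) auto
    finally show ?thesis using True by simp
  qed simp
  then have "(\<integral>\<^sup>+t. indicator {0<..<1} t * g t \<partial>lborel) \<le>
      (\<integral>\<^sup>+t. (\<Sum>m. d m * (indicator {a (Suc m)..<a m} t * ennreal (1 / t))) \<partial>lborel)"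
    by (intro nn_integral_mono)
  also have "\<dots> = (\<Sum>m. d m * (\<integral>\<^sup>+t. indicator {a (Suc m)..<a m} t * ennreal (1 / t) \<partial>lborel))"
    by (subst nn_integral_suminf) (auto simp: nn_integral_cmult)
  also have "\<dots> = (\<Sum>m. d m * ennreal (ln (a m) - ln (a (Suc m))))"
    using a by (subst nn_integral_inverse_block) (auto simp: decseq_def)
  finally show ?thesis .
qed

lemma nn_integral_blocks_ge:
  fixes a :: "nat \<Rightarrow> real" and g :: "real \<Rightarrow> ennreal"
  assumes a: "a 0 = 1" "\<And>m. 0 < a m" "decseq a"
    and g: "\<And>m t. a (Suc m) \<le> t \<Longrightarrow> t < a m \<Longrightarrow> d m * ennreal (1 / t) \<le> g t"
  shows "(\<Sum>m. d m * ennreal (ln (a m) - ln (a (Suc m)))) \<le> (\<integral>\<^sup>+t. indicator {0<..<1} t * g t \<partial>lborel)"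
proof -
  have le: "(\<Sum>m. d m * (indicator {a (Suc m)..<a m} t * ennreal (1 / t))) \<le> indicator {0<..<1} t * g t" for t
  proof (cases "\<exists>m. a (Suc m) \<le> t \<and> t < a m")
    case True
    then obtain m where m: "a (Suc m) \<le> t" "t < a m" by auto
    \<comment> \<open>At most one block contains \<open>t\<close>, so the series collapses to a
      single term.\<close>
    have "t \<notin> {a (Suc k)..<a k}" if "k \<noteq> m" for k
    proof (cases "k < m")
      case True
      then have "a m \<le> a (Suc k)" using a(3) by (auto simp: decseq_def)
      then show ?thesis using m by auto
    next
      case False
      then have "a k \<le> a (Suc m)" using a(3) that by (auto simp: decseq_def)
      then show ?thesis using m by auto
    qed
    then have "(\<Sum>m. d m * (indicator {a (Suc m)..<a m} t * ennreal (1 / t))) =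
        (\<Sum>m\<in>{m}. d m * (indicator {a (Suc m)..<a m} t * ennreal (1 / t)))"
      by (intro suminf_finite) auto
    also have "\<dots> \<le> g t" using m g[of m t] by simp
    finally show ?thesis
      using m a(1) a(2)[of "Suc m"] decseqD[OF a(3), of 0 m] by simp
  next
    case False
    then have "(\<Sum>m. d m * (indicator {a (Suc m)..<a m} t * ennreal (1 / t))) = (\<Sum>m. 0)"
      by (intro arg_cong[where f = suminf]) (auto simp: fun_eq_iff indicator_def)
    then show ?thesis by simp
  qed
  have "(\<Sum>m. d m * ennreal (ln (a m) - ln (a (Suc m)))) =
      (\<Sum>m. d m * (\<integral>\<^sup>+t. indicator {a (Suc m)..<a m} t * ennreal (1 / t) \<partial>lborel))"
    using a by (subst nn_integral_inverse_block) (auto simp: decseq_def)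
  also have "\<dots> = (\<integral>\<^sup>+t. (\<Sum>m. d m * (indicator {a (Suc m)..<a m} t * ennreal (1 / t))) \<partial>lborel)"
    by (subst nn_integral_suminf) (auto simp: nn_integral_cmult)
  also have "\<dots> \<le> (\<integral>\<^sup>+t. indicator {0<..<1} t * g t \<partial>lborel)"
    by (intro nn_integral_mono le)
  finally show ?thesis .
qed

section \<open>Decreasing rearrangements\<close>

locale fin_measure_domain =
  fixes \<Omega> :: "'a::euclidean_space set"
  assumes domain_sets [measurable]: "\<Omega> \<in> sets lebesgue"
    and domain_finite: "emeasure lebesgue \<Omega> < \<infinity>"
begin

lemma superlevel_sets:
  assumes "meas_on \<Omega> f" shows "{x \<in> \<Omega>. s < \<bar>f x\<bar>} \<in> sets lebesgue"
proof -
  have f [measurable]: "f \<in> borel_measurable (restrict_space lebesgue \<Omega>)"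
    using assms by (simp add: meas_on_def)
  have "{x \<in> space (restrict_space lebesgue \<Omega>). s < \<bar>f x\<bar>} \<in> sets (restrict_space lebesgue \<Omega>)"
    by measurable
  then show ?thesis
    by (simp add: sets_restrict_space_iff space_restrict_space)
qed

lemma distr_fun_mono:
  assumes "meas_on \<Omega> g" "\<And>x. x \<in> \<Omega> \<Longrightarrow> s < \<bar>f x\<bar> \<Longrightarrow> t < \<bar>g x\<bar>"
  shows "distr_fun \<Omega> f s \<le> distr_fun \<Omega> g t"
  unfolding distr_fun_def using superlevel_sets[OF assms(1)] assms(2)
  by (intro emeasure_mono) auto

text \<open>This makes the set under \<open>Inf\<close> in \<open>drearr\<close> nonempty: the
  superlevel sets decrease to the empty set and have finite measure, so their measures tend to 0. At
  \<open>t = 0\<close> an unbounded \<open>f\<close> leaves the set empty, hence the condition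
  \<open>0 < t\<close> on the facts about \<open>drearr\<close> below.\<close>

lemma distr_fun_eventually_le:
  assumes f: "meas_on \<Omega> f" and t: "0 < t"
  shows "\<exists>s\<ge>0. distr_fun \<Omega> f s \<le> ennreal t"
proof -
  define A where "A n = {x \<in> \<Omega>. real n < \<bar>f x\<bar>}" for n
  have "(\<lambda>n. emeasure lebesgue (A n)) \<longlonglongrightarrow> emeasure lebesgue (\<Inter>n. A n)"
  proof (rule Lim_emeasure_decseq)
    show "range A \<subseteq> sets lebesgue" using superlevel_sets[OF f] by (auto simp: A_def)
    show "decseq A" by (auto simp: A_def decseq_def)
    show "emeasure lebesgue (A n) \<noteq> \<infinity>" for n
      using emeasure_mono[of "A n" \<Omega> lebesgue] domain_finite by (auto simp: A_def top_unique)
  qed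
  moreover have "(\<Inter>n. A n) = {}"
    by (auto simp: A_def) (meson not_less_iff_gr_or_eq reals_Archimedean2)
  ultimately have "(\<lambda>n. emeasure lebesgue (A n)) \<longlonglongrightarrow> 0" by simp
  then have "\<forall>\<^sub>F n in sequentially. emeasure lebesgue (A n) < ennreal t"
    using t by (simp add: order_tendsto_iff)
  then obtain n where "emeasure lebesgue (A n) < ennreal t"
    by (auto simp: eventually_sequentially)
  then show ?thesis
    unfolding A_def distr_fun_def by (intro exI[of _ "real n"]) auto
qed

lemma drearr_le:
  assumes "0 \<le> s" "distr_fun \<Omega> f s \<le> ennreal t" shows "drearr \<Omega> f t \<le> s"
  unfolding drearr_def using assms by (intro cInf_lower) (auto intro: bdd_belowI[of _ 0])

lemma drearr_greatest:
  assumes "meas_on \<Omega> f" "0 < t" "\<And>s. 0 \<le> s \<Longrightarrow> distr_fun \<Omega> f s \<le> ennreal t \<Longrightarrow> b \<le> s"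
  shows "b \<le> drearr \<Omega> f t"
  unfolding drearr_def using assms distr_fun_eventually_le[of f t] by (intro cInf_greatest) auto

lemma drearr_nonneg: "meas_on \<Omega> f \<Longrightarrow> 0 < t \<Longrightarrow> 0 \<le> drearr \<Omega> f t"
  by (rule drearr_greatest)

lemma drearr_antimono: "meas_on \<Omega> f \<Longrightarrow> 0 < s \<Longrightarrow> s \<le> t \<Longrightarrow> drearr \<Omega> f t \<le> drearr \<Omega> f s"
  by (rule drearr_greatest) (auto intro: less_le_trans, blast intro: drearr_le order_trans ennreal_leI)

lemma drearr_mono:
  assumes "meas_on \<Omega> g" "0 < t" "\<And>x. x \<in> \<Omega> \<Longrightarrow> \<bar>f x\<bar> \<le> \<bar>g x\<bar>"
  shows "drearr \<Omega> f t \<le> drearr \<Omega> g t"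
proof (rule drearr_greatest[OF assms(1,2)])
  fix s assume s: "0 \<le> s" "distr_fun \<Omega> g s \<le> ennreal t"
  have "distr_fun \<Omega> f s \<le> distr_fun \<Omega> g s"
    using assms by (intro distr_fun_mono) force+
  with s show "drearr \<Omega> f t \<le> s" by (intro drearr_le) auto
qed

text \<open>Some admissible level lies below \<open>s\<close>. Staying strictly above the infimum
  avoids right-continuity of the distribution function; the price is an epsilon when the lemma is
  applied.\<close>

lemma distr_fun_above:
  assumes f: "meas_on \<Omega> f" and t: "0 < t" and s: "drearr \<Omega> f t < s"
  shows "distr_fun \<Omega> f s \<le> ennreal t"
proof -
  obtain u where u: "0 \<le> u" "distr_fun \<Omega> f u \<le> ennreal t" "u < s"
    using drearr_greatest[OF f t, of s] s by (meson not_le)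
  have "distr_fun \<Omega> f s \<le> distr_fun \<Omega> f u" using u f by (intro distr_fun_mono) auto
  with u show ?thesis by auto
qed

text \<open>Where |f| exceeds a + b, either |g| exceeds a or |h| exceeds b. Splitting the argument
  as well as the function is the substitute for subadditivity.\<close>

lemma drearr_add:
  assumes g: "meas_on \<Omega> g" and h: "meas_on \<Omega> h"
    and f: "\<And>x. x \<in> \<Omega> \<Longrightarrow> f x = g x + h x" and st: "0 < s" "0 < t"
  shows "drearr \<Omega> f (s + t) \<le> drearr \<Omega> g s + drearr \<Omega> h t"
proof -
  have le: "drearr \<Omega> f (s + t) \<le> a + b"
    if a: "0 \<le> a" "distr_fun \<Omega> g a \<le> ennreal s" and b: "0 \<le> b" "distr_fun \<Omega> h b \<le> ennreal t" for a b
  proof (rule drearr_le)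
    have "distr_fun \<Omega> f (a + b) \<le> emeasure lebesgue ({x \<in> \<Omega>. a < \<bar>g x\<bar>} \<union> {x \<in> \<Omega>. b < \<bar>h x\<bar>})"
      unfolding distr_fun_def using superlevel_sets[OF g] superlevel_sets[OF h] f
      by (intro emeasure_mono) (fastforce+)
    also have "\<dots> \<le> distr_fun \<Omega> g a + distr_fun \<Omega> h b"
      unfolding distr_fun_def using superlevel_sets[OF g] superlevel_sets[OF h]
      by (intro emeasure_subadditive) auto
    also have "\<dots> \<le> ennreal s + ennreal t" using a b by (intro add_mono)
    finally show "distr_fun \<Omega> f (a + b) \<le> ennreal (s + t)" using st by simp
  qed (use a b in auto)
  \<comment> \<open>The infimum is taken over the level of \<open>g\<close> with \<open>b\<close>
    fixed, and afterwards over \<open>b\<close>.\<close>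
  have "drearr \<Omega> f (s + t) - b \<le> drearr \<Omega> g s" if "0 \<le> b" "distr_fun \<Omega> h b \<le> ennreal t" for b
    using le that by (intro drearr_greatest[OF g st(1)]) (force simp: algebra_simps)
  then have "drearr \<Omega> f (s + t) - drearr \<Omega> g s \<le> drearr \<Omega> h t"
    by (intro drearr_greatest[OF h st(2)]) (force simp: algebra_simps)
  then show ?thesis by simp
qed

text \<open>Monotonicity may break at 0, where the infimum can be over the empty set. The line is
  therefore cut into \<open>{..0}\<close>, where \<open>ennreal t = 0\<close> makes the function
  constant, and \<open>{0<..}\<close>, where it decreases.\<close>

lemma drearr_measurable:
  assumes "meas_on \<Omega> f" shows "drearr \<Omega> f \<in> borel_measurable borel"
proof -
  have "drearr \<Omega> f t = drearr \<Omega> f 0" if "t \<le> 0" for t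
    using that by (simp add: drearr_def ennreal_neg)
  then have const: "mono_on {..0} (\<lambda>t. - drearr \<Omega> f t)"
    by (intro mono_onI) (metis atMost_iff order_refl)
  have mono: "mono_on {0<..} (\<lambda>t. - drearr \<Omega> f t)"
    using drearr_antimono[OF assms] by (intro mono_onI) auto
  have "(\<lambda>t. - drearr \<Omega> f t) \<in> borel_measurable borel"
    by (rule borel_measurable_piecewise_mono[of "{{..0}, {0<..}}"]) (use const mono in auto)
  from borel_measurable_uminus[OF this] show ?thesis by simp
qed

end

section \<open>Weighted integrals of decreasing functions\<close>

text \<open>For \<open>F\<close> the \<open>p\<close>-th power of the rearrangement this is the
  inner integral of \<rho>(f); its root \<open>epow (wint F (tcut k)) (1 / p)\<close> is the number
  h_k. Without the root it is additive over blocks.\<close>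

definition wint :: "(real \<Rightarrow> real) \<Rightarrow> real \<Rightarrow> ennreal" where
  "wint F t = (\<integral>\<^sup>+x. indicator {0..t} x * ennreal (F x * inverse (1 - ln x)) \<partial>lborel)"

lemma wint_mono: "s \<le> t \<Longrightarrow> wint F s \<le> wint F t"
  unfolding wint_def by (intro nn_integral_mono mult_right_mono) (auto simp: indicator_def)

text \<open>The quotient \<open>u / 2 ^ m\<close> lies in [1, 2]. The absolute value in the constant
  covers both signs of the exponent, as \<open>\<theta> * r - 1\<close> may have either.\<close>

lemma powr_dyadic_bounds:
  fixes u \<beta> :: real
  assumes "2 ^ m \<le> u" "u \<le> 2 ^ Suc m"
  shows "u powr \<beta> \<le> 2 powr \<bar>\<beta>\<bar> * 2 powr (\<beta> * real m)"
    and "2 powr - \<bar>\<beta>\<bar> * 2 powr (\<beta> * real m) \<le> u powr \<beta>"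
proof -
  define v where "v = u / 2 ^ m"
  have v: "1 \<le> v" "v \<le> 2" using assms by (auto simp: v_def field_simps)
  have "(2 ^ m :: real) powr \<beta> = 2 powr (\<beta> * real m)"
    by (simp add: powr_realpow[symmetric] powr_powr mult.commute)
  moreover have "u = 2 ^ m * v" by (simp add: v_def)
  ultimately have u: "u powr \<beta> = v powr \<beta> * 2 powr (\<beta> * real m)"
    using v by (simp add: powr_mult)
  have "v powr \<beta> \<le> v powr \<bar>\<beta>\<bar>" using v by (intro powr_mono) auto
  also have "\<dots> \<le> 2 powr \<bar>\<beta>\<bar>" using v by (intro powr_mono2) auto
  finally show "u powr \<beta> \<le> 2 powr \<bar>\<beta>\<bar> * 2 powr (\<beta> * real m)"
    unfolding u by (intro mult_right_mono) auto
  have "2 powr - \<bar>\<beta>\<bar> \<le> v powr - \<bar>\<beta>\<bar>" using v by (intro powr_mono2') auto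
  also have "\<dots> \<le> v powr \<beta>" using v by (intro powr_mono) auto
  finally show "2 powr - \<bar>\<beta>\<bar> * 2 powr (\<beta> * real m) \<le> u powr \<beta>"
    unfolding u by (intro mult_right_mono) auto
qed

text \<open>An abstraction of the \<open>p\<close>-th power of a decreasing rearrangement, so that
  the integral estimates speak of functions on the line only. Sign and monotonicity are asked for
  positive arguments, since \<open>drearr\<close> at 0 may be an unspecified value.\<close>

locale decreasing_profile =
  fixes F :: "real \<Rightarrow> real"
  assumes profile_measurable [measurable]: "F \<in> borel_measurable borel"
    and profile_nonneg: "0 < x \<Longrightarrow> 0 \<le> F x"
    and profile_antimono: "0 < x \<Longrightarrow> x \<le> y \<Longrightarrow> F y \<le> F x"
begin

text \<open>On the block below \<open>tcut m\<close> the profile is at least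
  \<open>F (tcut m)\<close>, the weight at least \<open>1 / 2 ^ Suc m\<close>, and the block has
  length at least \<open>tcut m / 2\<close>. The two halves lost make the constant 4.\<close>

lemma profile_tcut_le_wint: "ennreal (F (tcut m) * tcut m) \<le> ennreal (4 * 2 ^ m) * wint F (tcut m)"
proof -
  define c where "c = F (tcut m) / 2 ^ Suc m"
  have c: "0 \<le> c" by (simp add: c_def profile_nonneg)
  have "ennreal c * indicator {tcut (Suc m)..tcut m} x \<le>
      indicator {0..tcut m} x * ennreal (F x * inverse (1 - ln x))" for x
  proof (cases "x \<in> {tcut (Suc m)..tcut m}")
    case True
    then have x: "2 ^ m \<le> 1 - ln x" "1 - ln x \<le> 2 ^ Suc m" "0 < x"
      using one_minus_ln_block[of m x] by auto
    have "0 < 1 - ln x" using x(1) by (rule less_le_trans[rotated]) simp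
    then have "inverse (2 ^ Suc m) \<le> inverse (1 - ln x)"
      using x(2) by (intro le_imp_inverse_le)
    then have "c \<le> F x * inverse (1 - ln x)"
      unfolding c_def divide_inverse using x True profile_antimono[of x "tcut m"]
      by (intro mult_mono profile_nonneg) auto
    then show ?thesis using True x by (simp add: ennreal_leI)
  qed simp
  then have "(\<integral>\<^sup>+x. ennreal c * indicator {tcut (Suc m)..tcut m} x \<partial>lborel) \<le> wint F (tcut m)"
    unfolding wint_def by (intro nn_integral_mono)
  then have "ennreal c * ennreal (tcut m - tcut (Suc m)) \<le> wint F (tcut m)"
    using tcut_Suc_le[of m] by (simp add: nn_integral_cmult_indicator)
  then have le: "ennreal (4 * 2 ^ m) * ennreal (c * (tcut m - tcut (Suc m))) \<le> ennreal (4 * 2 ^ m) * wint F (tcut m)"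
    using c tcut_Suc_le[of m] by (intro mult_left_mono) (auto simp: ennreal_mult)
  have "F (tcut m) * tcut m \<le> 4 * 2 ^ m * (c * (tcut m - tcut (Suc m)))"
  proof -
    have "F (tcut m) * tcut m \<le> F (tcut m) * (2 * (tcut m - tcut (Suc m)))"
      using tcut_Suc_le_half[of m] by (intro mult_left_mono profile_nonneg) auto
    also have "\<dots> = 4 * 2 ^ m * (c * (tcut m - tcut (Suc m)))"
      by (simp add: c_def)
    finally show ?thesis .
  qed
  then have "ennreal (F (tcut m) * tcut m) \<le> ennreal (4 * 2 ^ m) * ennreal (c * (tcut m - tcut (Suc m)))"
    using c tcut_Suc_le[of m] by (subst ennreal_mult[symmetric]) (auto intro: ennreal_leI)
  with le show ?thesis by (rule order_trans[rotated])
qed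

text \<open>Between \<open>tcut 1 = 1/e\<close> and 1 the weight is at most 1 and \<open>F\<close>
  at most \<open>F (tcut 1)\<close>, so the missing piece is at most \<open>F (tcut 1)\<close>. This
  equals e times \<open>F (tcut 1) * tcut 1\<close>; with e \<le> 3 and the factor 8 of
  \<open>profile_tcut_le_wint\<close> it is at most 24 times the right-hand integral, and 25 = 1 +
  24.\<close>

lemma wint_1_le: "wint F 1 \<le> ennreal 25 * wint F (tcut 1)"
proof -
  have "indicator {0..1} x * ennreal (F x * inverse (1 - ln x)) \<le>
      indicator {0..tcut 1} x * ennreal (F x * inverse (1 - ln x)) + ennreal (F (tcut 1)) * indicator {0..1} x" for x
  proof (cases "tcut 1 \<le> x \<and> x \<le> 1")
    case True
    then have x: "0 < x" using tcut_pos[of 1] by linarith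
    have "1 \<le> 1 - ln x" using True x by simp
    then have "ln x \<le> 1" by linarith
    have "inverse (1 - ln x) \<le> inverse 1"
      using \<open>1 \<le> 1 - ln x\<close> by (intro le_imp_inverse_le) auto
    then have "F x * inverse (1 - ln x) \<le> F (tcut 1) * 1"
      using True x by (intro mult_mono profile_antimono profile_nonneg)
        (use \<open>ln x \<le> 1\<close> in auto)
    then show ?thesis using True x by (auto simp: indicator_def ennreal_leI)
  qed (auto simp: indicator_def)
  then have "wint F 1 \<le> (\<integral>\<^sup>+x. indicator {0..tcut 1} x * ennreal (F x * inverse (1 - ln x))
      + ennreal (F (tcut 1)) * indicator {0..1} x \<partial>lborel)"
    unfolding wint_def by (intro nn_integral_mono)
  also have "\<dots> = wint F (tcut 1) + ennreal (F (tcut 1))"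
    unfolding wint_def by (subst nn_integral_add) (auto simp: nn_integral_cmult_indicator)
  also have "ennreal (F (tcut 1)) \<le> ennreal 24 * wint F (tcut 1)"
  proof -
    have "ennreal (F (tcut 1)) = ennreal (exp 1) * ennreal (F (tcut 1) * tcut 1)"
      by (simp add: tcut_def profile_nonneg exp_minus flip: ennreal_mult)
    also have "\<dots> \<le> ennreal 3 * (ennreal (4 * 2 ^ 1) * wint F (tcut 1))"
      by (intro mult_mono profile_tcut_le_wint ennreal_leI exp_le) auto
    also have "\<dots> = ennreal 24 * wint F (tcut 1)"
      by (simp flip: mult.assoc ennreal_mult)
    finally show ?thesis .
  qed
  also have "wint F (tcut 1) + ennreal 24 * wint F (tcut 1) = (ennreal 1 + ennreal 24) * wint F (tcut 1)"
    unfolding distrib_right by simp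
  also have "ennreal 1 + ennreal 24 = ennreal 25"
    by (subst ennreal_plus[symmetric]) auto
  finally show ?thesis by (simp add: add_left_mono)
qed

lemma wint_tcut_le_blocks:
  "wint F (tcut m) \<le> (\<Sum>k. if m \<le> k
     then \<integral>\<^sup>+x. indicator {tcut (Suc k)..<tcut k} x * ennreal (F x * inverse (1 - ln x)) \<partial>lborel else 0)"
proof -
  let ?g = "\<lambda>k x. if m \<le> k then indicator {tcut (Suc k)..<tcut k} x * ennreal (F x * inverse (1 - ln x)) else 0"
  \<comment> \<open>The two excluded points are null: 0 lies in no block, and \<open>tcut m\<close>
    belongs to the half-open block before the \<open>m\<close>-th, if there is one.\<close>
  have le: "indicator {0..tcut m} x * ennreal (F x * inverse (1 - ln x)) \<le> (\<Sum>k. ?g k x)"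
    if "x \<noteq> 0" "x \<noteq> tcut m" for x
  proof (cases "0 < x \<and> x < tcut m")
    case True
    then obtain k where k: "tcut (Suc k) \<le> x" "x < tcut k"
      using block_cover[OF tcut_tendsto_0, of x] tcut_le_1[of m] by force
    have "m \<le> k"
    proof (rule ccontr)
      assume "\<not> m \<le> k"
      then have "tcut m \<le> tcut (Suc k)" by (intro tcut_antimono) auto
      with k True show False by linarith
    qed
    then have "indicator {0..tcut m} x * ennreal (F x * inverse (1 - ln x)) = (\<Sum>k\<in>{k}. ?g k x)"
      using k True by simp
    also have "\<dots> \<le> (\<Sum>k. ?g k x)" by (rule sum_le_suminf) auto
    finally show ?thesis .
  qed (use that in \<open>auto simp: indicator_def\<close>)
  have "wint F (tcut m) \<le> (\<integral>\<^sup>+x. (\<Sum>k. ?g k x) \<partial>lborel)"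
    unfolding wint_def using AE_lborel_singleton[of 0] AE_lborel_singleton[of "tcut m"]
    by (intro nn_integral_mono_AE, eventually_elim) (use le in auto)
  also have "\<dots> = (\<Sum>k. \<integral>\<^sup>+x. ?g k x \<partial>lborel)"
    by (subst nn_integral_suminf) auto
  also have "\<dots> = (\<Sum>k. if m \<le> k
     then \<integral>\<^sup>+x. indicator {tcut (Suc k)..<tcut k} x * ennreal (F x * inverse (1 - ln x)) \<partial>lborel else 0)"
    by (intro suminf_cong) auto
  finally show ?thesis .
qed

text \<open>Downward induction on \<open>j\<close>. On \<open>{0..tcut m}\<close> the truncation is
  at most \<open>F (tcut m)\<close>, which gives the base. Each step adds one block, where inserting
  the weight \<open>1 / (1 - ln x)\<close> costs at most \<open>2 ^ Suc j\<close>; the block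
  integral is then enlarged to \<open>wint F (tcut j)\<close>.\<close>

lemma nn_integral_truncated_profile_le:
  assumes "j \<le> m"
  shows "(\<integral>\<^sup>+x. indicator {0..tcut j} x * ennreal (min (F x) (F (tcut m))) \<partial>lborel)
    \<le> (\<Sum>i=j..m. ennreal (4 * 2 ^ i) * wint F (tcut i))"
  using assms
proof (induction rule: inc_induct)
  case base
  have "(\<integral>\<^sup>+x. indicator {0..tcut m} x * ennreal (min (F x) (F (tcut m))) \<partial>lborel) \<le>
      (\<integral>\<^sup>+x. ennreal (F (tcut m)) * indicator {0..tcut m} x \<partial>lborel)"
    by (intro nn_integral_mono) (auto simp: indicator_def ennreal_leI)
  also have "\<dots> = ennreal (F (tcut m) * tcut m)"
    by (simp add: nn_integral_cmult_indicator ennreal_mult profile_nonneg less_imp_le)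
  also have "\<dots> \<le> ennreal (4 * 2 ^ m) * wint F (tcut m)"
    by (rule profile_tcut_le_wint)
  finally show ?case by simp
next
  case (step j)
  have "indicator {0..tcut j} x * ennreal (min (F x) (F (tcut m))) \<le>
      indicator {0..tcut (Suc j)} x * ennreal (min (F x) (F (tcut m))) +
      ennreal (2 ^ Suc j) * (indicator {0..tcut j} x * ennreal (F x * inverse (1 - ln x)))" for x
  proof (cases "tcut (Suc j) \<le> x \<and> x \<le> tcut j")
    case True
    then have x: "2 ^ j \<le> 1 - ln x" "1 - ln x \<le> 2 ^ Suc j" "0 < x"
      using one_minus_ln_block[of j x] by auto
    have pos: "0 < 1 - ln x" using x(1) by (rule less_le_trans[rotated]) simp
    then have "F x * 1 \<le> F x * (2 ^ Suc j * inverse (1 - ln x))"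
      using x by (intro mult_left_mono profile_nonneg) (auto simp: field_simps)
    then have "min (F x) (F (tcut m)) \<le> 2 ^ Suc j * (F x * inverse (1 - ln x))"
      by (simp add: algebra_simps)
    then have "ennreal (min (F x) (F (tcut m))) \<le> ennreal (2 ^ Suc j) * ennreal (F x * inverse (1 - ln x))"
      using x pos by (simp add: ennreal_leI profile_nonneg flip: ennreal_mult del: power_Suc)
    then show ?thesis using True x by (auto simp: indicator_def simp del: power_Suc intro: add_increasing)
  qed (auto simp: indicator_def)
  then have "(\<integral>\<^sup>+x. indicator {0..tcut j} x * ennreal (min (F x) (F (tcut m))) \<partial>lborel) \<le>
      (\<integral>\<^sup>+x. indicator {0..tcut (Suc j)} x * ennreal (min (F x) (F (tcut m))) +
      ennreal (2 ^ Suc j) * (indicator {0..tcut j} x * ennreal (F x * inverse (1 - ln x))) \<partial>lborel)"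
    by (intro nn_integral_mono)
  also have "\<dots> = (\<integral>\<^sup>+x. indicator {0..tcut (Suc j)} x * ennreal (min (F x) (F (tcut m))) \<partial>lborel) +
      ennreal (2 ^ Suc j) * wint F (tcut j)"
    unfolding wint_def by (subst nn_integral_add) (auto simp: nn_integral_cmult)
  also have "\<dots> \<le> (\<Sum>i=Suc j..m. ennreal (4 * 2 ^ i) * wint F (tcut i)) + ennreal (4 * 2 ^ j) * wint F (tcut j)"
    by (intro add_mono step.IH mult_right_mono ennreal_leI) auto
  also have "\<dots> = (\<Sum>i=j..m. ennreal (4 * 2 ^ i) * wint F (tcut i))"
    using step.hyps by (simp add: sum.atLeast_Suc_atMost add.commute)
  finally show ?case .
qed

end

section \<open>Reduction of the Gamma norm to a series over the cut points\<close>

lemma wint_1_le_discrete: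
  assumes "decreasing_profile F" "0 < s"
  shows "epow (wint F (tcut 0)) s \<le> ennreal (25 powr s) * epow (wint F (tcut 1)) s"
proof -
  interpret decreasing_profile F by fact
  have "epow (wint F (tcut 0)) s \<le> epow (ennreal 25 * wint F (tcut 1)) s"
    using wint_1_le assms by (intro epow_mono) auto
  also have "\<dots> = ennreal (25 powr s) * epow (wint F (tcut 1)) s"
    using assms epow_ennreal[of 25 s] by (simp add: epow_mult)
  finally show ?thesis .
qed

text \<open>The estimates of the K-functional from above involve h_0, h_1, ..., those from below
  reach only h_1, h_2, .... Reindexing costs \<open>2 powr \<alpha>\<close>, and the first term is
  absorbed by the comparison of h_0 with h_1.\<close>

lemma suminf_shift_discrete:
  assumes F: "decreasing_profile F" and s: "0 < s"
  shows "(\<Sum>m. ennreal (2 powr (\<alpha> * real m)) * epow (wint F (tcut m)) s) \<le>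
    ennreal (25 powr s + 2 powr \<alpha>) * (\<Sum>m. ennreal (2 powr (\<alpha> * real m)) * epow (wint F (tcut (Suc m))) s)"
    (is "_ \<le> _ * ?D")
proof -
  have "(\<Sum>m. ennreal (2 powr (\<alpha> * real m)) * epow (wint F (tcut m)) s) =
      (\<Sum>m. ennreal (2 powr (\<alpha> * real (m + 1))) * epow (wint F (tcut (m + 1))) s) +
      (\<Sum>m<1. ennreal (2 powr (\<alpha> * real m)) * epow (wint F (tcut m)) s)"
    by (rule suminf_offset) simp
  also have "(\<Sum>m. ennreal (2 powr (\<alpha> * real (m + 1))) * epow (wint F (tcut (m + 1))) s) =
      (\<Sum>m. ennreal (2 powr \<alpha>) * (ennreal (2 powr (\<alpha> * real m)) * epow (wint F (tcut (Suc m))) s))"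
    by (intro suminf_cong) (simp add: algebra_simps powr_add ennreal_mult)
  also have "\<dots> = ennreal (2 powr \<alpha>) * ?D" by simp
  also have "(\<Sum>m<1. ennreal (2 powr (\<alpha> * real m)) * epow (wint F (tcut m)) s) = epow (wint F (tcut 0)) s"
    by simp
  also have "\<dots> \<le> ennreal (25 powr s) * ?D"
  proof -
    have "epow (wint F (tcut 1)) s = (\<Sum>m\<in>{0}. ennreal (2 powr (\<alpha> * real m)) * epow (wint F (tcut (Suc m))) s)"
      by simp
    also have "\<dots> \<le> ?D" by (rule sum_le_suminf) auto
    finally have "ennreal (25 powr s) * epow (wint F (tcut 1)) s \<le> ennreal (25 powr s) * ?D"
      by (rule mult_left_mono) simp
    with wint_1_le_discrete[OF F s] show ?thesis by (rule order_trans)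
  qed
  also have "ennreal (2 powr \<alpha>) * ?D + ennreal (25 powr s) * ?D = ennreal (25 powr s + 2 powr \<alpha>) * ?D"
    by (simp add: distrib_right add.commute)
  finally show ?thesis by (simp add: add_left_mono)
qed

text \<open>The logarithmic length of a block supplies the missing factor when the exponent
  \<open>\<alpha> - 1\<close> of the integral weight becomes \<open>\<alpha>\<close> in the
  series.\<close>

lemma ln_tcut_diff: "ln (tcut m) - ln (tcut (Suc m)) = 2 ^ m"
  by (simp add: tcut_def)

text \<open>On a block the logarithmic weight is constant up to
  \<open>2 powr \<bar>\<alpha> - 1\<bar>\<close>, and \<open>wint F\<close> lies between its values
  at the two ends. The upper bound therefore sees \<open>tcut m\<close>, the lower one
  \<open>tcut (Suc m)\<close>; \<open>suminf_shift_discrete\<close> closes the gap. The constant is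
  fixed before \<open>F\<close>, which makes it independent of the function.\<close>

lemma nn_integral_wint_equiv:
  assumes s: "0 < s"
  obtains C where "0 < C"
    "\<And>F. decreasing_profile F \<Longrightarrow>
       (\<integral>\<^sup>+t. indicator {0<..<1} t * ennreal (inverse t * (1 - ln t) powr (\<alpha> - 1)) * epow (wint F t) s \<partial>lborel)
       \<le> ennreal C * (\<Sum>m. ennreal (2 powr (\<alpha> * real m)) * epow (wint F (tcut (Suc m))) s)"
    "\<And>F. decreasing_profile F \<Longrightarrow>
       (\<Sum>m. ennreal (2 powr (\<alpha> * real m)) * epow (wint F (tcut (Suc m))) s) \<le> ennreal C *
       (\<integral>\<^sup>+t. indicator {0<..<1} t * ennreal (inverse t * (1 - ln t) powr (\<alpha> - 1)) * epow (wint F t) s \<partial>lborel)"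
proof -
  define c where "c = 2 powr \<bar>\<alpha> - 1\<bar>"
  have c: "0 < c" "2 powr - \<bar>\<alpha> - 1\<bar> = 1 / c" by (auto simp: c_def powr_minus field_simps)
  have pw: "2 powr ((\<alpha> - 1) * real m) * 2 ^ m = 2 powr (\<alpha> * real m)" for m
    by (simp add: powr_realpow[symmetric] algebra_simps flip: powr_add)
  have dec: "decseq tcut" by (simp add: decseq_def tcut_antimono)
  have upper: "(\<integral>\<^sup>+t. indicator {0<..<1} t * ennreal (inverse t * (1 - ln t) powr (\<alpha> - 1)) * epow (wint F t) s \<partial>lborel)
       \<le> ennreal (c * (25 powr s + 2 powr \<alpha>)) * (\<Sum>m. ennreal (2 powr (\<alpha> * real m)) * epow (wint F (tcut (Suc m))) s)"
    (is "?R \<le> _ * ?D")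
    if F: "decreasing_profile F" for F
  proof -
    have "?R = (\<integral>\<^sup>+t. indicator {0<..<1} t * (ennreal (inverse t * (1 - ln t) powr (\<alpha> - 1)) * epow (wint F t) s) \<partial>lborel)"
      by (simp add: mult.assoc)
    also have "\<dots> \<le> (\<Sum>m. (ennreal (c * 2 powr ((\<alpha> - 1) * real m)) * epow (wint F (tcut m)) s) * ennreal (ln (tcut m) - ln (tcut (Suc m))))"
    proof (rule nn_integral_blocks_le[OF tcut_0 tcut_pos dec tcut_tendsto_0])
      fix m t assume t: "tcut (Suc m) \<le> t" "t < tcut m"
      then have u: "2 ^ m \<le> 1 - ln t" "1 - ln t \<le> 2 ^ Suc m" "0 < t"
        using one_minus_ln_block[of m t] by auto
      have "inverse t * (1 - ln t) powr (\<alpha> - 1) \<le> (c * 2 powr ((\<alpha> - 1) * real m)) * (1 / t)"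
        using powr_dyadic_bounds(1)[OF u(1,2), of "\<alpha> - 1"] u(3) by (simp add: c_def field_simps)
      then have "ennreal (inverse t * (1 - ln t) powr (\<alpha> - 1)) \<le> ennreal (c * 2 powr ((\<alpha> - 1) * real m)) * ennreal (1 / t)"
        using u(3) c(1) by (subst ennreal_mult[symmetric]) (auto intro: ennreal_leI)
      moreover have "epow (wint F t) s \<le> epow (wint F (tcut m)) s"
        using t s by (intro epow_mono wint_mono) auto
      ultimately have "ennreal (inverse t * (1 - ln t) powr (\<alpha> - 1)) * epow (wint F t) s \<le>
          (ennreal (c * 2 powr ((\<alpha> - 1) * real m)) * ennreal (1 / t)) * epow (wint F (tcut m)) s"
        by (rule mult_mono) auto
      then show "ennreal (inverse t * (1 - ln t) powr (\<alpha> - 1)) * epow (wint F t) s \<le>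
          (ennreal (c * 2 powr ((\<alpha> - 1) * real m)) * epow (wint F (tcut m)) s) * ennreal (1 / t)"
        by (simp add: mult_ac)
    qed
    also have "\<dots> = (\<Sum>m. ennreal c * (ennreal (2 powr (\<alpha> * real m)) * epow (wint F (tcut m)) s))"
    proof (intro suminf_cong)
      fix m
      have "ennreal (c * 2 powr ((\<alpha> - 1) * real m)) * ennreal (2 ^ m) = ennreal c * ennreal (2 powr (\<alpha> * real m))"
        using c(1) pw[of m] by (simp add: mult.assoc flip: ennreal_mult del: ennreal_power)
      then show "(ennreal (c * 2 powr ((\<alpha> - 1) * real m)) * epow (wint F (tcut m)) s) * ennreal (ln (tcut m) - ln (tcut (Suc m)))
          = ennreal c * (ennreal (2 powr (\<alpha> * real m)) * epow (wint F (tcut m)) s)"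
        unfolding ln_tcut_diff by (metis mult.assoc mult.commute)
    qed
    also have "\<dots> = ennreal c * (\<Sum>m. ennreal (2 powr (\<alpha> * real m)) * epow (wint F (tcut m)) s)"
      by simp
    also have "\<dots> \<le> ennreal c * (ennreal (25 powr s + 2 powr \<alpha>) * ?D)"
      by (intro mult_left_mono suminf_shift_discrete F s) auto
    also have "\<dots> = ennreal (c * (25 powr s + 2 powr \<alpha>)) * ?D"
      using c(1) by (simp add: ennreal_mult mult.assoc del: ennreal_plus)
    finally show ?thesis .
  qed
  have lower: "(\<Sum>m. ennreal (2 powr (\<alpha> * real m)) * epow (wint F (tcut (Suc m))) s) \<le> ennreal c *
       (\<integral>\<^sup>+t. indicator {0<..<1} t * ennreal (inverse t * (1 - ln t) powr (\<alpha> - 1)) * epow (wint F t) s \<partial>lborel)"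
    (is "?D \<le> _ * ?R")
    if F: "decreasing_profile F" for F
  proof -
    have "(\<Sum>m. ennreal (1 / c) * (ennreal (2 powr (\<alpha> * real m)) * epow (wint F (tcut (Suc m))) s)) =
      (\<Sum>m. (ennreal (1 / c * 2 powr ((\<alpha> - 1) * real m)) * epow (wint F (tcut (Suc m))) s) * ennreal (ln (tcut m) - ln (tcut (Suc m))))"
    proof (intro suminf_cong)
      fix m
      have "ennreal (1 / c * 2 powr ((\<alpha> - 1) * real m)) * ennreal (2 ^ m) = ennreal (1 / c) * ennreal (2 powr (\<alpha> * real m))"
        using c(1) pw[of m] by (simp add: mult.assoc flip: ennreal_mult del: ennreal_power)
      then show "ennreal (1 / c) * (ennreal (2 powr (\<alpha> * real m)) * epow (wint F (tcut (Suc m))) s) =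
          (ennreal (1 / c * 2 powr ((\<alpha> - 1) * real m)) * epow (wint F (tcut (Suc m))) s) * ennreal (ln (tcut m) - ln (tcut (Suc m)))"
        unfolding ln_tcut_diff by (metis mult.assoc mult.commute)
    qed
    also have "\<dots> \<le> (\<integral>\<^sup>+t. indicator {0<..<1} t * (ennreal (inverse t * (1 - ln t) powr (\<alpha> - 1)) * epow (wint F t) s) \<partial>lborel)"
    proof (rule nn_integral_blocks_ge[OF tcut_0 tcut_pos dec])
      fix m t assume t: "tcut (Suc m) \<le> t" "t < tcut m"
      then have u: "2 ^ m \<le> 1 - ln t" "1 - ln t \<le> 2 ^ Suc m" "0 < t"
        using one_minus_ln_block[of m t] by auto
      have "(1 / c * 2 powr ((\<alpha> - 1) * real m)) * (1 / t) \<le> inverse t * (1 - ln t) powr (\<alpha> - 1)"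
        using powr_dyadic_bounds(2)[OF u(1,2), of "\<alpha> - 1"] u(3) unfolding c(2) by (simp add: field_simps)
      then have "ennreal (1 / c * 2 powr ((\<alpha> - 1) * real m)) * ennreal (1 / t) \<le> ennreal (inverse t * (1 - ln t) powr (\<alpha> - 1))"
        using u(3) c(1) by (subst ennreal_mult[symmetric]) (auto intro: ennreal_leI)
      moreover have "epow (wint F (tcut (Suc m))) s \<le> epow (wint F t) s"
        using t s by (intro epow_mono wint_mono) auto
      ultimately have "(ennreal (1 / c * 2 powr ((\<alpha> - 1) * real m)) * ennreal (1 / t)) * epow (wint F (tcut (Suc m))) s \<le>
          ennreal (inverse t * (1 - ln t) powr (\<alpha> - 1)) * epow (wint F t) s"
        by (rule mult_mono) auto
      then show "(ennreal (1 / c * 2 powr ((\<alpha> - 1) * real m)) * epow (wint F (tcut (Suc m))) s) * ennreal (1 / t) \<le>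
          ennreal (inverse t * (1 - ln t) powr (\<alpha> - 1)) * epow (wint F t) s"
        by (simp add: mult_ac)
    qed
    also have "\<dots> = ?R" by (simp add: mult.assoc)
    finally have "ennreal (1 / c) * ?D \<le> ?R" by simp
    then have "ennreal c * (ennreal (1 / c) * ?D) \<le> ennreal c * ?R" by (rule mult_left_mono) simp
    moreover have "ennreal c * (ennreal (1 / c) * ?D) = ?D"
      using c(1) by (simp flip: mult.assoc ennreal_mult)
    ultimately show ?thesis by simp
  qed
  show ?thesis
  \<comment> \<open>The sum of the two one-sided constants serves both inequalities.\<close>
  proof (rule that[of "c * (25 powr s + 2 powr \<alpha>) + c"])
    show "0 < c * (25 powr s + 2 powr \<alpha>) + c" using c(1) by (simp add: add_nonneg_pos)
  next
    fix F assume F: "decreasing_profile F"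
    show "(\<integral>\<^sup>+t. indicator {0<..<1} t * ennreal (inverse t * (1 - ln t) powr (\<alpha> - 1)) * epow (wint F t) s \<partial>lborel)
       \<le> ennreal (c * (25 powr s + 2 powr \<alpha>) + c) * (\<Sum>m. ennreal (2 powr (\<alpha> * real m)) * epow (wint F (tcut (Suc m))) s)"
      using c(1) by (intro order_trans[OF upper[OF F]] mult_right_mono ennreal_leI) auto
    show "(\<Sum>m. ennreal (2 powr (\<alpha> * real m)) * epow (wint F (tcut (Suc m))) s) \<le> ennreal (c * (25 powr s + 2 powr \<alpha>) + c) *
       (\<integral>\<^sup>+t. indicator {0<..<1} t * ennreal (inverse t * (1 - ln t) powr (\<alpha> - 1)) * epow (wint F t) s \<partial>lborel)"
      using c(1) by (intro order_trans[OF lower[OF F]] mult_right_mono ennreal_leI) auto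
  qed
qed

section \<open>The K-functional from below\<close>

lemma powr_add_le_real:
  fixes a b p :: real
  assumes "0 \<le> a" "0 \<le> b" "0 \<le> p"
  shows "(a + b) powr p \<le> 2 powr p * (a powr p + b powr p)"
proof -
  have "(a + b) powr p \<le> (2 * max a b) powr p" using assms by (intro powr_mono2) auto
  also have "\<dots> = 2 powr p * max a b powr p" using assms by (simp add: powr_mult)
  also have "\<dots> \<le> 2 powr p * (a powr p + b powr p)" by (intro mult_left_mono) (auto simp: max_def)
  finally show ?thesis .
qed

lemma epow_ennreal_inverse_power: "ennreal ((2 ^ k) powr (- 1 / p)) = epow (ennreal (1 / 2 ^ k)) (1 / p)"
  using powr_divide[of 1 "2 ^ k" "1 / p"] powr_minus_divide[of "2 ^ k" "1 / p"]
  by (simp add: epow_ennreal)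

section \<open>Reduction of the interpolation norm to a dyadic series\<close>

lemma Kfun_le_mult:
  assumes c: "1 \<le> c" and t: "0 \<le> t'" "t \<le> c * t'"
  shows "Kfun \<Omega> p f t \<le> ennreal c * Kfun \<Omega> p f t'"
proof -
  \<comment> \<open>With the constant moved to the left, the right-hand side is a bare infimum and
    can be treated one decomposition at a time, including the case that there is none.\<close>
  have "ennreal (1 / c) * Kfun \<Omega> p f t \<le> Kfun \<Omega> p f t'"
    unfolding Kfun_def[of _ _ _ t']
  proof (intro INF_greatest)
    fix gg assume gg: "gg \<in> {(g0, g1). g0 \<in> grand_space \<Omega> p \<and> g1 \<in> small_space \<Omega> p \<and> (\<forall>x\<in>\<Omega>. f x = g0 x + g1 x)}"
    have "Kfun \<Omega> p f t \<le> grand_norm \<Omega> p (fst gg) + ennreal t * small_norm \<Omega> p (snd gg)"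
      unfolding Kfun_def by (rule INF_lower) fact
    also have "\<dots> \<le> ennreal c * grand_norm \<Omega> p (fst gg) + ennreal (c * t') * small_norm \<Omega> p (snd gg)"
    proof (intro add_mono mult_right_mono)
      show "grand_norm \<Omega> p (fst gg) \<le> ennreal c * grand_norm \<Omega> p (fst gg)"
        using mult_right_mono[of 1 "ennreal c" "grand_norm \<Omega> p (fst gg)"] c by simp
    qed (use t in \<open>auto intro: ennreal_leI\<close>)
    also have "\<dots> = ennreal c * (grand_norm \<Omega> p (fst gg) + ennreal t' * small_norm \<Omega> p (snd gg))"
      using c t by (simp add: distrib_left ennreal_mult mult.assoc)
    finally have "ennreal (1 / c) * Kfun \<Omega> p f t \<le>
        ennreal (1 / c) * (ennreal c * (grand_norm \<Omega> p (fst gg) + ennreal t' * small_norm \<Omega> p (snd gg)))"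
      by (rule mult_left_mono) simp
    also have "\<dots> = grand_norm \<Omega> p (fst gg) + ennreal t' * small_norm \<Omega> p (snd gg)"
      using c by (simp flip: mult.assoc ennreal_mult)
    finally show "ennreal (1 / c) * Kfun \<Omega> p f t \<le> grand_norm \<Omega> p (fst gg) + ennreal t' * small_norm \<Omega> p (snd gg)" .
  qed
  then have "ennreal c * (ennreal (1 / c) * Kfun \<Omega> p f t) \<le> ennreal c * Kfun \<Omega> p f t'"
    by (rule mult_left_mono) simp
  then show ?thesis using c by (simp flip: mult.assoc ennreal_mult)
qed

lemma Kfun_mono: "0 \<le> t \<Longrightarrow> t \<le> t' \<Longrightarrow> Kfun \<Omega> p f t \<le> Kfun \<Omega> p f t'"
  using Kfun_le_mult[of 1 t' t \<Omega> p f] by simp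

text \<open>Between consecutive powers of 1/2 the K-functional changes at most by a factor 2, and
  each interval has logarithmic length ln 2. In the first constant \<open>\<theta> * r\<close> comes
  from evaluating \<open>t powr - \<theta>\<close> at the left end and \<open>r\<close> from
  doubling the K-functional there; the 2 of the second comes from 1 \<le> 2 ln 2.\<close>

lemma nn_integral_Kfun_equiv:
  fixes \<theta> r :: real
  assumes \<theta>: "0 < \<theta>" and r: "0 < r"
  shows "(\<integral>\<^sup>+t. indicator {0<..<1} t * epow (ennreal (t powr - \<theta>) * Kfun \<Omega> p f t) r * ennreal (1 / t) \<partial>lborel)
      \<le> ennreal (2 powr (\<theta> * r + r)) * (\<Sum>m. ennreal (2 powr (\<theta> * r * real m)) * epow (Kfun \<Omega> p f (1 / 2 ^ Suc m)) r)"
      (is "?I \<le> _ * ?L")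
    and "(\<Sum>m. ennreal (2 powr (\<theta> * r * real m)) * epow (Kfun \<Omega> p f (1 / 2 ^ Suc m)) r)
      \<le> ennreal 2 * (\<integral>\<^sup>+t. indicator {0<..<1} t * epow (ennreal (t powr - \<theta>) * Kfun \<Omega> p f t) r * ennreal (1 / t) \<partial>lborel)"
proof -
  define a where "a m = (1 / 2 :: real) ^ m" for m
  have a: "a 0 = 1" "\<And>m. 0 < a m" "decseq a" "a \<longlonglongrightarrow> 0"
    unfolding a_def by (auto simp: decseq_def power_decreasing intro!: LIMSEQ_realpow_zero)
  have a_Suc: "a (Suc m) = 1 / 2 ^ Suc m" for m by (simp add: a_def power_divide)
  have ln_a: "ln (a m) - ln (a (Suc m)) = ln 2" for m
    by (simp add: a_def ln_realpow ln_mult ln_div algebra_simps)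
  have a_powr: "a m powr - \<theta> = 2 powr (\<theta> * real m)" for m
  proof -
    have "a m = 2 powr - real m"
      by (simp add: a_def powr_minus powr_realpow power_one_over inverse_eq_divide)
    then show ?thesis by (simp only: powr_powr) (simp add: mult.commute)
  qed
  have I: "?I = (\<integral>\<^sup>+t. indicator {0<..<1} t * (epow (ennreal (t powr - \<theta>) * Kfun \<Omega> p f t) r * ennreal (1 / t)) \<partial>lborel)"
    by (simp add: mult.assoc)
  define k where "k m = Kfun \<Omega> p f (a (Suc m))" for m
  have L: "?L = (\<Sum>m. ennreal (2 powr (\<theta> * r * real m)) * epow (k m) r)"
    by (simp add: k_def a_Suc)
  have "?I \<le> (\<Sum>m. (ennreal (2 powr (\<theta> * r * real (Suc m)) * 2 powr r) * epow (k m) r) * ennreal (ln (a m) - ln (a (Suc m))))"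
    unfolding I
  proof (rule nn_integral_blocks_le[OF a])
    fix m t assume t: "a (Suc m) \<le> t" "t < a m"
    have "t powr - \<theta> \<le> a (Suc m) powr - \<theta>" using t a(2)[of "Suc m"] \<theta> by (intro powr_mono2') auto
    then have tp: "t powr - \<theta> \<le> 2 powr (\<theta> * real (Suc m))" unfolding a_powr .
    have "Kfun \<Omega> p f t \<le> ennreal 2 * k m"
      unfolding k_def using t a(2)[of "Suc m"] by (intro Kfun_le_mult) (auto simp: a_def)
    with tp have "epow (ennreal (t powr - \<theta>) * Kfun \<Omega> p f t) r \<le> epow (ennreal (2 powr (\<theta> * real (Suc m))) * (ennreal 2 * k m)) r"
      using r by (intro epow_mono mult_mono ennreal_leI) auto
    also have "\<dots> = ennreal (2 powr (\<theta> * r * real (Suc m)) * 2 powr r) * epow (k m) r"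
      using r by (simp add: epow_mult epow_ennreal powr_powr ennreal_mult mult_ac del: of_nat_Suc ennreal_numeral)
    finally show "epow (ennreal (t powr - \<theta>) * Kfun \<Omega> p f t) r * ennreal (1 / t) \<le>
        (ennreal (2 powr (\<theta> * r * real (Suc m)) * 2 powr r) * epow (k m) r) * ennreal (1 / t)"
      by (rule mult_right_mono) simp
  qed
  also have "\<dots> \<le> (\<Sum>m. ennreal (2 powr (\<theta> * r + r)) * (ennreal (2 powr (\<theta> * r * real m)) * epow (k m) r))"
  proof (intro suminf_le)
    fix m
    have "(ennreal (2 powr (\<theta> * r * real (Suc m)) * 2 powr r) * epow (k m) r) * ennreal (ln (a m) - ln (a (Suc m)))
        \<le> (ennreal (2 powr (\<theta> * r * real (Suc m)) * 2 powr r) * epow (k m) r) * ennreal 1"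
      unfolding ln_a using ln_2_less_1 by (intro mult_left_mono ennreal_leI) auto
    also have "\<dots> = ennreal (2 powr (\<theta> * r + r) * 2 powr (\<theta> * r * real m)) * epow (k m) r"
      by (simp add: algebra_simps flip: powr_add)
    finally show "(ennreal (2 powr (\<theta> * r * real (Suc m)) * 2 powr r) * epow (k m) r) * ennreal (ln (a m) - ln (a (Suc m)))
        \<le> ennreal (2 powr (\<theta> * r + r)) * (ennreal (2 powr (\<theta> * r * real m)) * epow (k m) r)"
      by (subst (asm) (2) ennreal_mult) (auto simp: mult.assoc)
  qed auto
  finally show "?I \<le> ennreal (2 powr (\<theta> * r + r)) * ?L" unfolding L by simp
  have "?L \<le> (\<Sum>m. ennreal 2 * ((ennreal (2 powr (\<theta> * r * real m)) * epow (k m) r) * ennreal (ln (a m) - ln (a (Suc m)))))"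
    unfolding L
  proof (intro suminf_le)
    fix m
    have "ennreal 1 \<le> ennreal (2 * ln 2)" using ln2_ge_two_thirds by (intro ennreal_leI) auto
    then have "(ennreal (2 powr (\<theta> * r * real m)) * epow (k m) r) * ennreal 1 \<le>
      (ennreal (2 powr (\<theta> * r * real m)) * epow (k m) r) * ennreal (2 * ln 2)"
      by (rule mult_left_mono) simp
    then show "ennreal (2 powr (\<theta> * r * real m)) * epow (k m) r \<le>
      ennreal 2 * ((ennreal (2 powr (\<theta> * r * real m)) * epow (k m) r) * ennreal (ln (a m) - ln (a (Suc m))))"
      unfolding ln_a by (simp add: ennreal_mult mult_ac)
  qed auto
  also have "\<dots> = ennreal 2 * (\<Sum>m. (ennreal (2 powr (\<theta> * r * real m)) * epow (k m) r) * ennreal (ln (a m) - ln (a (Suc m))))"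
    by (rule ennreal_suminf_cmult)
  also have "\<dots> \<le> ennreal 2 * ?I"
    unfolding I
  proof (intro mult_left_mono nn_integral_blocks_ge[OF a(1-3)])
    fix m t assume t: "a (Suc m) \<le> t" "t < a m"
    then have "0 < t" using a(2)[of "Suc m"] by linarith
    then have "a m powr - \<theta> \<le> t powr - \<theta>" using t \<theta> by (intro powr_mono2') auto
    then have "epow (ennreal (2 powr (\<theta> * real m)) * k m) r \<le> epow (ennreal (t powr - \<theta>) * Kfun \<Omega> p f t) r"
      unfolding a_powr k_def using r t a(2)[of "Suc m"]
      by (intro epow_mono mult_mono ennreal_leI Kfun_mono) auto
    moreover have "epow (ennreal (2 powr (\<theta> * real m)) * k m) r = ennreal (2 powr (\<theta> * r * real m)) * epow (k m) r"
      using r by (simp add: epow_mult epow_ennreal powr_powr mult_ac)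
    ultimately show "ennreal (2 powr (\<theta> * r * real m)) * epow (k m) r * ennreal (1 / t) \<le>
        epow (ennreal (t powr - \<theta>) * Kfun \<Omega> p f t) r * ennreal (1 / t)"
      by (intro mult_right_mono) auto
  qed auto
  finally show "?L \<le> ennreal 2 * ?I" .
qed

section \<open>Lower bounds for both norms and for an arbitrary decomposition\<close>

context fin_measure_domain
begin

lemma decreasing_profile_drearr:
  assumes f: "meas_on \<Omega> f" and p: "0 < p"
  shows "decreasing_profile (\<lambda>x. drearr \<Omega> f x powr p)"
proof
  show "(\<lambda>x. drearr \<Omega> f x powr p) \<in> borel_measurable borel"
    using drearr_measurable[OF f] by measurable
qed (use f p in \<open>auto intro!: powr_mono2 drearr_nonneg drearr_antimono\<close>)

lemma drearr_half_sum:
  assumes "meas_on \<Omega> g0" "meas_on \<Omega> g1" "\<And>x. x \<in> \<Omega> \<Longrightarrow> f x = g0 x + g1 x" "meas_on \<Omega> f"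
    and x: "0 < x" and p: "0 < p"
  shows "drearr \<Omega> f x powr p \<le> 2 powr p * (drearr \<Omega> g0 (x / 2) powr p + drearr \<Omega> g1 (x / 2) powr p)"
proof -
  have "drearr \<Omega> f x \<le> drearr \<Omega> g0 (x / 2) + drearr \<Omega> g1 (x / 2)"
    using drearr_add[of g0 g1 f "x / 2" "x / 2"] assms by simp
  then have "drearr \<Omega> f x powr p \<le> (drearr \<Omega> g0 (x / 2) + drearr \<Omega> g1 (x / 2)) powr p"
    using assms by (intro powr_mono2 drearr_nonneg) auto
  also have "\<dots> \<le> 2 powr p * (drearr \<Omega> g0 (x / 2) powr p + drearr \<Omega> g1 (x / 2) powr p)"
    using assms by (intro powr_add_le_real drearr_nonneg) auto
  finally show ?thesis .
qed

text \<open>The supremum is tested at the single point \<open>tcut (Suc k)\<close>; the successor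
  keeps this point below 1.\<close>

lemma grand_norm_ge:
  assumes "0 < p"
  shows "ennreal (1 / 2 ^ Suc k) * (\<integral>\<^sup>+x. indicator {tcut (Suc k)..1} x * ennreal (drearr \<Omega> g x powr p) \<partial>lborel)
    \<le> epow (grand_norm \<Omega> p g) p" (is "_ * ?P \<le> _")
proof -
  have "ennreal ((1 - ln (tcut (Suc k))) powr (- 1 / p)) * epow ?P (1 / p) \<le> grand_norm \<Omega> p g"
    unfolding grand_norm_def using tcut_less_1[of k] by (intro SUP_upper) auto
  then have "epow (ennreal (1 / 2 ^ Suc k) * ?P) (1 / p) \<le> grand_norm \<Omega> p g"
    unfolding one_minus_ln_tcut epow_ennreal_inverse_power using assms by (simp add: epow_mult)
  from epow_mono[OF _ this, of p] show ?thesis using assms by (simp add: epow_epow)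
qed

text \<open>Of the outer integral only the \<open>k\<close>-th block is kept. There the inner
  integral is at least the one up to \<open>tcut (Suc k)\<close>, the weight is at least
  \<open>(2 ^ Suc k) powr (- 1 / p)\<close>, and the logarithmic mass is \<open>2 ^ k\<close>, whose
  inverse appears as \<open>2 / 2 ^ Suc k\<close>.\<close>

lemma small_norm_ge:
  assumes p: "0 < p"
  shows "ennreal (1 / 2 ^ Suc k) * (\<integral>\<^sup>+x. indicator {0..tcut (Suc k)} x * ennreal (drearr \<Omega> g x powr p) \<partial>lborel)
    \<le> epow (ennreal (2 / 2 ^ Suc k) * small_norm \<Omega> p g) p" (is "_ * ?Q \<le> _")
proof -
  let ?c = "epow (ennreal (1 / 2 ^ Suc k) * ?Q) (1 / p)"
  have "ennreal (2 ^ k) * ?c = ?c * ennreal (ln (tcut k) - ln (tcut (Suc k)))"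
    unfolding ln_tcut_diff by (rule mult.commute)
  also have "\<dots> = ?c * (\<integral>\<^sup>+t. indicator {tcut (Suc k)..<tcut k} t * ennreal (1 / t) \<partial>lborel)"
    by (subst nn_integral_inverse_block) (auto simp: tcut_Suc_le)
  also have "\<dots> = (\<integral>\<^sup>+t. ?c * (indicator {tcut (Suc k)..<tcut k} t * ennreal (1 / t)) \<partial>lborel)"
    by (rule nn_integral_cmult[symmetric]) auto
  also have "\<dots> \<le> small_norm \<Omega> p g"
    unfolding small_norm_def
  proof (intro nn_integral_mono)
    fix t :: real
    show "?c * (indicator {tcut (Suc k)..<tcut k} t * ennreal (1 / t)) \<le>
      indicator {0<..<1} t * ennreal ((1 - ln t) powr (- 1 / p) / t) *
      epow (\<integral>\<^sup>+x. indicator {0..t} x * ennreal (drearr \<Omega> g x powr p) \<partial>lborel) (1 / p)"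
    proof (cases "tcut (Suc k) \<le> t \<and> t < tcut k")
      case True
      then have t: "2 ^ k \<le> 1 - ln t" "1 - ln t \<le> 2 ^ Suc k" "0 < t"
        using one_minus_ln_block[of k t] by auto
      have "t < 1" using True tcut_le_1[of k] by linarith
      have pos: "0 < 1 - ln t" using t(1) by (rule less_le_trans[rotated]) simp
      have "(2 ^ Suc k) powr (- 1 / p) \<le> (1 - ln t) powr (- 1 / p)"
        using t pos p by (intro powr_mono2') auto
      then have "(2 ^ Suc k) powr (- 1 / p) * (1 / t) \<le> (1 - ln t) powr (- 1 / p) / t"
        using t(3) by (simp add: divide_right_mono)
      then have "ennreal ((2 ^ Suc k) powr (- 1 / p)) * ennreal (1 / t) \<le> ennreal ((1 - ln t) powr (- 1 / p) / t)"
        using t(3) by (subst ennreal_mult[symmetric]) (auto intro: ennreal_leI)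
      moreover have "epow ?Q (1 / p) \<le> epow (\<integral>\<^sup>+x. indicator {0..t} x * ennreal (drearr \<Omega> g x powr p) \<partial>lborel) (1 / p)"
        using True p by (intro epow_mono nn_integral_mono mult_right_mono) (auto simp: indicator_def)
      ultimately have "(ennreal ((2 ^ Suc k) powr (- 1 / p)) * ennreal (1 / t)) * epow ?Q (1 / p) \<le>
        ennreal ((1 - ln t) powr (- 1 / p) / t) *
        epow (\<integral>\<^sup>+x. indicator {0..t} x * ennreal (drearr \<Omega> g x powr p) \<partial>lborel) (1 / p)"
        by (rule mult_mono) auto
      then show ?thesis
        unfolding epow_ennreal_inverse_power using True t(3) \<open>t < 1\<close> p by (simp add: epow_mult mult_ac)
    qed auto
  qed
  finally have "ennreal (2 / 2 ^ Suc k) * (ennreal (2 ^ k) * ?c) \<le> ennreal (2 / 2 ^ Suc k) * small_norm \<Omega> p g"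
    by (rule mult_left_mono) simp
  moreover have "ennreal (2 / 2 ^ Suc k) * ennreal (2 ^ k) = 1"
    by (subst ennreal_mult[symmetric]) auto
  ultimately have "?c \<le> ennreal (2 / 2 ^ Suc k) * small_norm \<Omega> p g"
    by (simp flip: mult.assoc)
  from epow_mono[OF _ this, of p] show ?thesis using p by (simp add: epow_epow)
qed

lemma nn_integral_half_le:
  fixes h :: "real \<Rightarrow> real"
  assumes [measurable]: "h \<in> borel_measurable borel" and "\<And>y. a \<le> 2 * y \<Longrightarrow> 2 * y < b \<Longrightarrow> y \<in> A"
  shows "(\<integral>\<^sup>+x. indicator {a..<b} x * ennreal (h (x / 2)) \<partial>lborel) \<le> 2 * (\<integral>\<^sup>+y. indicator A y * ennreal (h y) \<partial>lborel)"
proof -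
  have "(\<integral>\<^sup>+x. indicator {a..<b} x * ennreal (h (x / 2)) \<partial>lborel) =
      ennreal \<bar>2\<bar> * (\<integral>\<^sup>+y. indicator {a..<b} (0 + 2 * y) * ennreal (h ((0 + 2 * y) / 2)) \<partial>lborel)"
    by (rule nn_integral_real_affine) auto
  also have "\<dots> \<le> 2 * (\<integral>\<^sup>+y. indicator A y * ennreal (h y) \<partial>lborel)"
    using assms(2) by (auto intro!: mult_left_mono nn_integral_mono simp: indicator_def)
  finally show ?thesis .
qed

text \<open>For every decomposition f = g0 + g1 the rearrangement of f at x is bounded by those of
  g0 and g1 at x/2. The halved block lies in \<open>{tcut (k + 3)..1}\<close>, which the grand norm
  controls, and in \<open>{0..tcut (k + 1)}\<close>, which the small norm controls. In the constant,
  \<open>2 powr p\<close> outside comes from the power of a sum, 2 from the substitution, 4 from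
  \<open>2 ^ (k + 3) / 2 ^ (k + 1)\<close>, and the inner \<open>2 powr p\<close> from the numerator
  2 in \<open>small_norm_ge\<close>.\<close>

lemma block_le_Kfun:
  assumes f: "meas_on \<Omega> f" and p: "1 < p"
  shows "epow (\<integral>\<^sup>+x. indicator {tcut (Suc (Suc k))..<tcut (Suc k)} x * ennreal (drearr \<Omega> f x powr p * inverse (1 - ln x)) \<partial>lborel) (1 / p)
    \<le> ennreal ((2 powr p * 2 * (4 + 2 powr p)) powr (1 / p)) * Kfun \<Omega> p f (1 / 2 ^ Suc k)" (is "epow ?b _ \<le> ennreal ?c * _")
proof -
  have "0 < 4 + 2 powr p" by (intro add_pos_nonneg) auto
  then have c: "0 < ?c" by simp
  have "ennreal (1 / ?c) * epow ?b (1 / p) \<le> Kfun \<Omega> p f (1 / 2 ^ Suc k)"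
    unfolding Kfun_def
  proof (intro INF_greatest, clarify)
    fix g0 g1 assume g: "g0 \<in> grand_space \<Omega> p" "g1 \<in> small_space \<Omega> p" "\<forall>x\<in>\<Omega>. f x = g0 x + g1 x"
    define M where "M = grand_norm \<Omega> p g0 + ennreal (1 / 2 ^ Suc k) * small_norm \<Omega> p g1"
    have g0: "meas_on \<Omega> g0" and g1: "meas_on \<Omega> g1"
      using g by (auto simp: grand_space_def small_space_def)
    define h0 h1 where "h0 x = drearr \<Omega> g0 x powr p" and "h1 x = drearr \<Omega> g1 x powr p" for x
    have [measurable]: "h0 \<in> borel_measurable borel" "h1 \<in> borel_measurable borel"
      unfolding h0_def h1_def using drearr_measurable[OF g0] drearr_measurable[OF g1] by measurable
    let ?J = "{tcut (Suc (Suc k))..<tcut (Suc k)}"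
    \<comment> \<open>The lower end is one cut point beyond that of the block, because of the
      argument x/2.\<close>
    define P where "P = (\<integral>\<^sup>+x. indicator {tcut (Suc (Suc (Suc k)))..1} x * ennreal (h0 x) \<partial>lborel)"
    define Q where "Q = (\<integral>\<^sup>+x. indicator {0..tcut (Suc k)} x * ennreal (h1 x) \<partial>lborel)"
    have P: "ennreal (1 / 2 ^ Suc k) * P \<le> ennreal 4 * epow M p"
    proof -
      have "ennreal (1 / 2 ^ Suc k) * P = ennreal 4 * (ennreal (1 / 2 ^ Suc (Suc (Suc k))) * P)"
        by (simp add: mult.assoc[symmetric] ennreal_mult[symmetric] del: ennreal_numeral)
      also have "\<dots> \<le> ennreal 4 * epow (grand_norm \<Omega> p g0) p"
        unfolding P_def h0_def using p by (intro mult_left_mono grand_norm_ge) auto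
      also have "\<dots> \<le> ennreal 4 * epow M p"
        using p by (intro mult_left_mono epow_mono) (auto simp: M_def)
      finally show ?thesis .
    qed
    have Q: "ennreal (1 / 2 ^ Suc k) * Q \<le> ennreal (2 powr p) * epow M p"
    proof -
      have "ennreal (1 / 2 ^ Suc k) * Q \<le> epow (ennreal (2 / 2 ^ Suc k) * small_norm \<Omega> p g1) p"
        unfolding Q_def h1_def using p by (intro small_norm_ge) auto
      also have "ennreal (2 / 2 ^ Suc k) = ennreal 2 * ennreal (1 / 2 ^ Suc k)"
        by (subst ennreal_mult[symmetric]) auto
      also have "epow (ennreal 2 * ennreal (1 / 2 ^ Suc k) * small_norm \<Omega> p g1) p \<le> epow (ennreal 2 * M) p"
        unfolding mult.assoc using p by (intro epow_mono mult_left_mono) (auto simp: M_def)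
      also have "\<dots> = ennreal (2 powr p) * epow M p"
        using p by (simp add: epow_mult epow_ennreal del: ennreal_numeral)
      finally show ?thesis .
    qed
    have "?b \<le> (\<integral>\<^sup>+x. ennreal (2 powr p * (1 / 2 ^ Suc k)) *
        (indicator ?J x * ennreal (h0 (x / 2)) + indicator ?J x * ennreal (h1 (x / 2))) \<partial>lborel)"
    proof (intro nn_integral_mono)
      fix x :: real
      show "indicator ?J x * ennreal (drearr \<Omega> f x powr p * inverse (1 - ln x)) \<le>
        ennreal (2 powr p * (1 / 2 ^ Suc k)) *
        (indicator ?J x * ennreal (h0 (x / 2)) + indicator ?J x * ennreal (h1 (x / 2)))"
      proof (cases "x \<in> ?J")
        case True
        then have x: "2 ^ Suc k \<le> 1 - ln x" "0 < x"
          using one_minus_ln_block[of "Suc k" x] by auto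
        have "0 < 1 - ln x" using x(1) by (rule less_le_trans[rotated]) simp
        then have ln_le: "ln x \<le> 1" by linarith
        have "inverse (1 - ln x) \<le> inverse (2 ^ Suc k)" by (intro le_imp_inverse_le x) auto
        then have "drearr \<Omega> f x powr p * inverse (1 - ln x) \<le> (2 powr p * (h0 (x / 2) + h1 (x / 2))) * (1 / 2 ^ Suc k)"
          unfolding h0_def h1_def inverse_eq_divide using x g(3) p
          by (intro mult_mono drearr_half_sum g0 g1 f) (use ln_le in auto)
        also have "\<dots> = (2 powr p * (1 / 2 ^ Suc k)) * (h0 (x / 2) + h1 (x / 2))" by (simp add: mult_ac)
        finally have "ennreal (drearr \<Omega> f x powr p * inverse (1 - ln x)) \<le>
            ennreal (2 powr p * (1 / 2 ^ Suc k)) * (ennreal (h0 (x / 2)) + ennreal (h1 (x / 2)))"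
          by (subst ennreal_plus[symmetric], simp add: h0_def, simp add: h1_def, subst ennreal_mult[symmetric])
            (auto simp: h0_def h1_def intro: ennreal_leI)
        then show ?thesis using True by simp
      qed simp
    qed
    also have "\<dots> = ennreal (2 powr p * (1 / 2 ^ Suc k)) *
        ((\<integral>\<^sup>+x. indicator ?J x * ennreal (h0 (x / 2)) \<partial>lborel) + (\<integral>\<^sup>+x. indicator ?J x * ennreal (h1 (x / 2)) \<partial>lborel))"
      by (simp add: nn_integral_cmult nn_integral_add)
    also have "\<dots> \<le> ennreal (2 powr p * (1 / 2 ^ Suc k)) * (2 * P + 2 * Q)"
    proof (intro mult_left_mono add_mono)
      show "(\<integral>\<^sup>+x. indicator ?J x * ennreal (h0 (x / 2)) \<partial>lborel) \<le> 2 * P"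
        unfolding P_def using tcut_Suc_le_half[of "Suc (Suc k)"] tcut_le_1[of "Suc k"] tcut_pos[of "Suc k"]
        by (intro nn_integral_half_le) auto
      show "(\<integral>\<^sup>+x. indicator ?J x * ennreal (h1 (x / 2)) \<partial>lborel) \<le> 2 * Q"
        unfolding Q_def using tcut_pos[of "Suc (Suc k)"] tcut_pos[of "Suc k"]
        by (intro nn_integral_half_le; simp; linarith)
    qed auto
    also have "\<dots> = ennreal (2 powr p * 2) * (ennreal (1 / 2 ^ Suc k) * P + ennreal (1 / 2 ^ Suc k) * Q)"
    proof -
      have "ennreal (2 powr p * (1 / 2 ^ Suc k)) = ennreal (2 powr p) * ennreal (1 / 2 ^ Suc k)"
        "ennreal (2 powr p * 2) = ennreal (2 powr p) * 2"
        by (rule ennreal_mult, simp, simp) (simp add: ennreal_mult)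
      then show ?thesis by (simp only: distrib_left mult_ac)
    qed
    also have "\<dots> \<le> ennreal (2 powr p * 2) * (ennreal 4 * epow M p + ennreal (2 powr p) * epow M p)"
      by (intro mult_left_mono add_mono P Q) auto
    also have "\<dots> = ennreal (2 powr p * 2 * (4 + 2 powr p)) * epow M p"
      by (simp add: ennreal_mult distrib_right mult.assoc)
    finally have "epow ?b (1 / p) \<le> epow (ennreal (2 powr p * 2 * (4 + 2 powr p)) * epow M p) (1 / p)"
      using p by (intro epow_mono) auto
    also have "\<dots> = ennreal ?c * M"
      using p by (simp add: epow_mult epow_epow epow_ennreal del: ennreal_plus)
    finally have "ennreal (1 / ?c) * epow ?b (1 / p) \<le> ennreal (1 / ?c) * (ennreal ?c * M)"
      by (rule mult_left_mono) simp
    also have "\<dots> = M"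
    proof -
      have "ennreal (1 / ?c) * ennreal ?c = 1" using c by (subst ennreal_mult[symmetric]) auto
      then show ?thesis by (simp only: mult.assoc[symmetric] mult_1)
    qed
    finally show "ennreal (1 / ?c) * epow ?b (1 / p) \<le> grand_norm \<Omega> p (fst (g0, g1)) + ennreal (1 / 2 ^ Suc k) * small_norm \<Omega> p (snd (g0, g1))"
      by (simp add: M_def)
  qed
  then have "ennreal ?c * (ennreal (1 / ?c) * epow ?b (1 / p)) \<le> ennreal ?c * Kfun \<Omega> p f (1 / 2 ^ Suc k)"
    by (rule mult_left_mono) simp
  moreover have "ennreal ?c * ennreal (1 / ?c) = 1" using c by (subst ennreal_mult[symmetric]) auto
  ultimately show ?thesis by (simp only: mult.assoc[symmetric] mult_1)
qed

end

section \<open>The small norm of a truncation\<close>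

lemma measurable_epow [measurable]: "(\<lambda>x. epow x a) \<in> borel_measurable borel"
  unfolding epow_def by measurable

text \<open>Written as a condition on the pair (t, x), the integrand is visibly jointly measurable,
  and the integral over x is then measurable in t.\<close>

lemma nn_integral_atMost_measurable:
  fixes h :: "real \<Rightarrow> ennreal"
  assumes [measurable]: "h \<in> borel_measurable borel"
  shows "(\<lambda>t. \<integral>\<^sup>+x. indicator {0..t} x * h x \<partial>lborel) \<in> borel_measurable borel"
proof -
  have "(\<lambda>t. \<integral>\<^sup>+x. (if 0 \<le> x \<and> x \<le> t then h x else 0) \<partial>lborel) \<in> borel_measurable borel"
    by measurable
  also have "(\<lambda>t. \<integral>\<^sup>+x. (if 0 \<le> x \<and> x \<le> t then h x else 0) \<partial>lborel) =
      (\<lambda>t. \<integral>\<^sup>+x. indicator {0..t} x * h x \<partial>lborel)"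
    by (intro ext nn_integral_cong) (auto simp: indicator_def)
  finally show ?thesis .
qed

context decreasing_profile
begin

text \<open>This majorizes the part t < \<open>tcut m\<close> of the small norm of a truncation: the
  inner integral is at most \<open>F (tcut m) * t\<close>, and the logarithmic weight is replaced by
  its largest value. Integrating \<open>t powr (1 / p - 1)\<close> gives the factor
  \<open>p\<close>; the factor 4 is that of \<open>profile_tcut_le_wint\<close>.\<close>

lemma small_integral_head:
  assumes p: "0 < p"
  shows "(\<integral>\<^sup>+t. ennreal ((2 ^ m) powr (- 1 / p) * F (tcut m) powr (1 / p) * t powr (1 / p - 1)) * indicator {0..tcut m} t \<partial>lborel)
    \<le> ennreal (p * 4 powr (1 / p)) * epow (wint F (tcut m)) (1 / p)"
proof -
  let ?A = "(2 ^ m) powr (- 1 / p) * F (tcut m) powr (1 / p)"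
  have F: "0 \<le> F (tcut m)" by (simp add: profile_nonneg)
  have "((\<lambda>t. t powr (1 / p - 1)) has_integral (tcut m powr (1 / p - 1 + 1) / (1 / p - 1 + 1))) {0..tcut m}"
    using p by (intro has_integral_powr_from_0) (auto simp: less_imp_le)
  then have "((\<lambda>t. ?A * t powr (1 / p - 1)) has_integral (?A * (p * tcut m powr (1 / p)))) {0..tcut m}"
    by (intro has_integral_mult_right) (simp add: mult.commute)
  then have "(\<integral>\<^sup>+t. ennreal (?A * t powr (1 / p - 1)) * indicator {0..tcut m} t \<partial>lborel) = ennreal (?A * (p * tcut m powr (1 / p)))"
    by (intro nn_integral_has_integral_lebesgue') auto
  also have "?A * (p * tcut m powr (1 / p)) = p * ((2 ^ m) powr (- 1 / p) * (F (tcut m) * tcut m) powr (1 / p))"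
    using F by (simp add: powr_mult less_imp_le)
  also have "ennreal \<dots> = ennreal p * (ennreal ((2 ^ m) powr (- 1 / p)) * ennreal ((F (tcut m) * tcut m) powr (1 / p)))"
    using p by (simp add: ennreal_mult)
  also have "ennreal ((2 ^ m) powr (- 1 / p)) * ennreal ((F (tcut m) * tcut m) powr (1 / p)) =
      epow (ennreal (1 / 2 ^ m) * ennreal (F (tcut m) * tcut m)) (1 / p)"
    using p F epow_ennreal_inverse_power[of m p] epow_ennreal[of "F (tcut m) * tcut m" "1 / p"]
    by (simp add: epow_mult less_imp_le)
  also have "ennreal p * \<dots> \<le> ennreal p * epow (ennreal (1 / 2 ^ m) * (ennreal (4 * 2 ^ m) * wint F (tcut m))) (1 / p)"
    using p by (intro mult_left_mono epow_mono profile_tcut_le_wint) auto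
  also have "ennreal (1 / 2 ^ m) * (ennreal (4 * 2 ^ m) * wint F (tcut m)) = ennreal 4 * wint F (tcut m)"
    unfolding mult.assoc[symmetric] by (subst ennreal_mult[symmetric]) auto
  also have "ennreal p * epow (ennreal 4 * wint F (tcut m)) (1 / p) = ennreal (p * 4 powr (1 / p)) * epow (wint F (tcut m)) (1 / p)"
    using p by (simp add: epow_mult epow_ennreal ennreal_mult mult.assoc del: ennreal_numeral)
  finally show ?thesis .
qed

end

text \<open>The block mass \<open>2 ^ j\<close> is the 1/p-th power of \<open>(2 ^ j) powr p\<close>
  and can be moved inside. The coefficient of the i-th summand then becomes 2^(-(p-1)(i-j)) times
  2^(ip), a kernel that decays because p > 1. The sequence fed to it is chosen so that its 1/p-th
  power is \<open>2 ^ k\<close> times h_k up to a constant.\<close>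

lemma small_integral_tail_term:
  assumes F: "decreasing_profile F" and p: "1 < p" and jm: "j \<le> m"
  shows "ennreal ((2 ^ j) powr (- 1 / p)) *
      epow (\<integral>\<^sup>+x. indicator {0..tcut j} x * ennreal (min (F x) (F (tcut m))) \<partial>lborel) (1 / p) * ennreal (2 ^ j)
    \<le> epow (\<Sum>k. ennreal ((2 powr - (p - 1)) ^ ((j - k) + (k - j))) *
        (if k \<le> m then ennreal (4 * (2 ^ k) powr p) * wint F (tcut k) else 0)) (1 / p)"
    (is "_ * epow ?\<Psi> _ * _ \<le> epow (\<Sum>k. ?q k * ?X k) _")
proof -
  interpret decreasing_profile F by fact
  let ?c = "1 / 2 ^ j * (2 ^ j) powr p :: real"
  \<comment> \<open>With i = j + d the exponents agree: -j + jp + i = -(p-1)d + ip.\<close>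
  have coeff: "?c * (4 * 2 ^ i) = (2 powr - (p - 1)) ^ ((j - i) + (i - j)) * (4 * (2 ^ i) powr p)" if "j \<le> i" for i
  proof -
    from le_Suc_ex[OF that] obtain d where i: "i = j + d" by blast
    have pow: "(2 ^ n :: real) = 2 powr real n" for n by (rule powr_realpow[symmetric]) simp
    have "?c * 2 ^ i = 2 powr (- real j + real j * p + real i)"
      unfolding pow powr_powr powr_add by (simp add: powr_minus inverse_eq_divide)
    also have "- real j + real j * p + real i = (- (p - 1)) * real d + real i * p"
      by (simp add: i algebra_simps)
    also have "2 powr ((- (p - 1)) * real d + real i * p) = (2 powr - (p - 1)) ^ d * (2 ^ i) powr p"
      unfolding pow powr_powr powr_add by (subst powr_power) (auto simp: mult.commute)
    finally have "4 * (?c * 2 ^ i) = 4 * ((2 powr - (p - 1)) ^ d * (2 ^ i) powr p)"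
      by (rule arg_cong)
    then show ?thesis unfolding mult.left_commute[of _ 4] by (simp add: i)
  qed
  have "ennreal ((2 ^ j) powr (- 1 / p)) * epow ?\<Psi> (1 / p) * ennreal (2 ^ j) = epow (ennreal ?c * ?\<Psi>) (1 / p)"
  proof -
    have "ennreal (2 ^ j) = epow (ennreal ((2 ^ j) powr p)) (1 / p)"
      using p by (simp add: epow_ennreal powr_powr del: ennreal_power)
    moreover have "ennreal ?c = ennreal (1 / 2 ^ j) * ennreal ((2 ^ j) powr p)"
      by (rule ennreal_mult) auto
    ultimately show ?thesis
      unfolding epow_ennreal_inverse_power using p by (simp add: epow_mult mult_ac)
  qed
  also have "\<dots> \<le> epow (ennreal ?c * (\<Sum>i=j..m. ennreal (4 * 2 ^ i) * wint F (tcut i))) (1 / p)"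
    using p jm by (intro epow_mono mult_left_mono nn_integral_truncated_profile_le) auto
  also have "ennreal ?c * (\<Sum>i=j..m. ennreal (4 * 2 ^ i) * wint F (tcut i)) = (\<Sum>i=j..m. ?q i * ?X i)"
    unfolding sum_distrib_left
  proof (intro sum.cong refl)
    fix i assume i: "i \<in> {j..m}"
    have "ennreal ?c * (ennreal (4 * 2 ^ i) * wint F (tcut i)) = ennreal (?c * (4 * 2 ^ i)) * wint F (tcut i)"
      by (subst (2) ennreal_mult) (auto simp: mult.assoc)
    also have "\<dots> = ennreal ((2 powr - (p - 1)) ^ ((j - i) + (i - j)) * (4 * (2 ^ i) powr p)) * wint F (tcut i)"
      using i by (subst coeff) auto
    also have "\<dots> = ?q i * ?X i"
      using i by (subst ennreal_mult) (auto simp: mult.assoc)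
    finally show "ennreal ?c * (ennreal (4 * 2 ^ i) * wint F (tcut i)) = ?q i * ?X i" .
  qed
  also have "epow (\<Sum>i=j..m. ?q i * ?X i) (1 / p) \<le> epow (\<Sum>k. ?q k * ?X k) (1 / p)"
    using p by (intro epow_mono sum_le_suminf) auto
  finally show ?thesis .
qed

text \<open>The Hardy inequality is applied with the exponent 1/p < 1; this turns the sums inside
  the root into an l^1 sum of the \<open>2 ^ k\<close> h_k. \<open>G\<close> is only assumed to lie
  below the truncated profile, since for the rearrangement of a truncated function only this bound
  is established.\<close>

lemma small_integral_truncated_le:
  fixes p :: real
  assumes p: "1 < p"
  obtains C where "0 < C"
    "\<And>F G m. decreasing_profile F \<Longrightarrow> (\<And>x. 0 < x \<Longrightarrow> G x \<le> min (F x) (F (tcut m))) \<Longrightarrow>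
      (\<integral>\<^sup>+t. indicator {0<..<1} t * ennreal ((1 - ln t) powr (- 1 / p) / t) *
        epow (\<integral>\<^sup>+x. indicator {0..t} x * ennreal (G x) \<partial>lborel) (1 / p) \<partial>lborel)
      \<le> ennreal C * (\<Sum>k\<le>m. ennreal (2 ^ k) * epow (wint F (tcut k)) (1 / p))"
proof -
  have "0 < 2 powr - (p - 1)" "2 powr - (p - 1) < 1" "0 < 1 / p"
    using p by (auto simp: powr_less_one)
  from discrete_hardy[OF this] obtain C where C: "0 < C"
    "\<And>X :: nat \<Rightarrow> ennreal. (\<Sum>m. epow (\<Sum>k. ennreal ((2 powr - (p - 1)) ^ ((m - k) + (k - m))) * X k) (1 / p))
        \<le> ennreal C * (\<Sum>k. epow (X k) (1 / p))" by blast
  have "(\<integral>\<^sup>+t. indicator {0<..<1} t * ennreal ((1 - ln t) powr (- 1 / p) / t) *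
        epow (\<integral>\<^sup>+x. indicator {0..t} x * ennreal (G x) \<partial>lborel) (1 / p) \<partial>lborel)
      \<le> ennreal (p * 4 powr (1 / p) + C * 4 powr (1 / p)) * (\<Sum>k\<le>m. ennreal (2 ^ k) * epow (wint F (tcut k)) (1 / p))"
    (is "?I \<le> _ * ?S")
    if F: "decreasing_profile F" and G: "\<And>x. 0 < x \<Longrightarrow> G x \<le> min (F x) (F (tcut m))" for F G m
  proof -
    interpret decreasing_profile F by fact
    define \<Psi> where "\<Psi> t = (\<integral>\<^sup>+x. indicator {0..t} x * ennreal (min (F x) (F (tcut m))) \<partial>lborel)" for t
    have [measurable]: "\<Psi> \<in> borel_measurable borel"
      unfolding \<Psi>_def by (intro nn_integral_atMost_measurable) measurable
    have \<Psi>_mono: "\<Psi> s \<le> \<Psi> t" if "s \<le> t" for s t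
      unfolding \<Psi>_def using that by (intro nn_integral_mono mult_right_mono) (auto simp: indicator_def)
    have \<Psi>_le: "\<Psi> t \<le> ennreal (F (tcut m) * t)" if "0 \<le> t" for t
    proof -
      have "\<Psi> t \<le> (\<integral>\<^sup>+x. ennreal (F (tcut m)) * indicator {0..t} x \<partial>lborel)"
        unfolding \<Psi>_def by (intro nn_integral_mono) (auto simp: indicator_def ennreal_leI)
      then show ?thesis
        using that by (simp add: nn_integral_cmult_indicator ennreal_mult profile_nonneg)
    qed
    have G\<Psi>: "(\<integral>\<^sup>+x. indicator {0..t} x * ennreal (G x) \<partial>lborel) \<le> \<Psi> t" for t
    proof -
      have "AE x in lborel. indicator {0..t} x * ennreal (G x) \<le> indicator {0..t} x * ennreal (min (F x) (F (tcut m)))"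
        using AE_lborel_singleton[of 0]
        by eventually_elim (use G in \<open>auto simp: indicator_def intro!: ennreal_leI\<close>)
      then show ?thesis unfolding \<Psi>_def by (rule nn_integral_mono_AE)
    qed
    define g where "g t = ennreal ((1 - ln t) powr (- 1 / p) / t) * epow (\<Psi> t) (1 / p)" for t
    have [measurable]: "g \<in> borel_measurable borel" unfolding g_def by measurable
    \<comment> \<open>The outer integral is cut at \<open>tcut m\<close>. Below, freezing the
      logarithm leaves an integrable power of t; above, only the blocks j < m occur and are summed
      by the Hardy inequality.\<close>
    let ?head = "\<lambda>t. ennreal ((2 ^ m) powr (- 1 / p) * F (tcut m) powr (1 / p) * t powr (1 / p - 1)) * indicator {0..tcut m} t"
    let ?tail = "\<lambda>t. indicator {0<..<1} t * (if tcut m \<le> t then g t else 0)"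
    have "?I \<le> (\<integral>\<^sup>+t. ?head t + ?tail t \<partial>lborel)"
    proof (intro nn_integral_mono)
      fix t :: real
      have "indicator {0<..<1} t * ennreal ((1 - ln t) powr (- 1 / p) / t) *
        epow (\<integral>\<^sup>+x. indicator {0..t} x * ennreal (G x) \<partial>lborel) (1 / p) \<le> indicator {0<..<1} t * g t"
        unfolding g_def mult.assoc using p by (intro mult_left_mono epow_mono G\<Psi>) auto
      also have "\<dots> \<le> ?head t + ?tail t"
      proof (cases "0 < t \<and> t < tcut m")
        case True
        have "ln t < ln (tcut m)" using True by simp
        then have u: "2 ^ m \<le> 1 - ln t" using one_minus_ln_tcut[of m] by linarith
        have "(1 - ln t) powr (- 1 / p) / t \<le> (2 ^ m) powr (- 1 / p) / t"
          using u True p by (intro divide_right_mono powr_mono2') auto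
        moreover have "epow (\<Psi> t) (1 / p) \<le> epow (ennreal (F (tcut m) * t)) (1 / p)"
          using \<Psi>_le[of t] True p by (intro epow_mono) auto
        ultimately have "g t \<le> ennreal ((2 ^ m) powr (- 1 / p) / t) * ennreal ((F (tcut m) * t) powr (1 / p))"
          unfolding g_def using True
          by (intro mult_mono ennreal_leI) (auto simp: epow_ennreal profile_nonneg)
        also have "\<dots> = ennreal ((2 ^ m) powr (- 1 / p) * F (tcut m) powr (1 / p) * t powr (1 / p - 1))"
          using True by (simp add: powr_mult profile_nonneg powr_diff flip: ennreal_mult)
        finally show ?thesis using True by (auto simp: indicator_def intro: add_increasing2)
      qed (auto simp: indicator_def)
      finally show "indicator {0<..<1} t * ennreal ((1 - ln t) powr (- 1 / p) / t) *
        epow (\<integral>\<^sup>+x. indicator {0..t} x * ennreal (G x) \<partial>lborel) (1 / p) \<le> ?head t + ?tail t" .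
    qed
    also have "\<dots> = (\<integral>\<^sup>+t. ?head t \<partial>lborel) + (\<integral>\<^sup>+t. ?tail t \<partial>lborel)"
      by (intro nn_integral_add) measurable
    also have "(\<integral>\<^sup>+t. ?head t \<partial>lborel) \<le> ennreal (p * 4 powr (1 / p)) * ?S"
    proof -
      have "1 * epow (wint F (tcut m)) (1 / p) \<le> ennreal (2 ^ m) * epow (wint F (tcut m)) (1 / p)"
        using ennreal_leI[of 1 "2 ^ m"] by (intro mult_right_mono) auto
      also have "\<dots> \<le> ?S" by (rule member_le_sum) auto
      finally have "epow (wint F (tcut m)) (1 / p) \<le> ?S" by simp
      then have "ennreal (p * 4 powr (1 / p)) * epow (wint F (tcut m)) (1 / p) \<le> ennreal (p * 4 powr (1 / p)) * ?S"
        by (rule mult_left_mono) simp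
      with small_integral_head[of p m] p show ?thesis by (auto intro: order_trans)
    qed
    also have "(\<integral>\<^sup>+t. ?tail t \<partial>lborel) \<le> ennreal (C * 4 powr (1 / p)) * ?S"
    proof -
      \<comment> \<open>The zero default for j \<ge> m is correct because those blocks lie below
        \<open>tcut m\<close>, where the tail vanishes.\<close>
      define d where "d j = (if j < m then ennreal ((2 ^ j) powr (- 1 / p)) * epow (\<Psi> (tcut j)) (1 / p) else 0)" for j
      let ?X = "\<lambda>k. if k \<le> m then ennreal (4 * (2 ^ k) powr p) * wint F (tcut k) else 0"
      have "decseq tcut" by (simp add: decseq_def tcut_antimono)
      then have "(\<integral>\<^sup>+t. ?tail t \<partial>lborel) \<le> (\<Sum>j. d j * ennreal (ln (tcut j) - ln (tcut (Suc j))))"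
      proof (rule nn_integral_blocks_le[OF tcut_0 tcut_pos _ tcut_tendsto_0])
        fix j t assume t: "tcut (Suc j) \<le> t" "t < tcut j"
        show "(if tcut m \<le> t then g t else 0) \<le> d j * ennreal (1 / t)"
        proof (cases "tcut m \<le> t")
          case True
          have "j < m"
          proof (rule ccontr)
            assume "\<not> j < m"
            then have "tcut j \<le> tcut m" by (intro tcut_antimono) auto
            with t True show False by linarith
          qed
          have u: "2 ^ j \<le> 1 - ln t" "0 < t" using one_minus_ln_block[of j t] t by auto
          have "(1 - ln t) powr (- 1 / p) / t \<le> (2 ^ j) powr (- 1 / p) * (1 / t)"
            using u p by (auto intro!: divide_right_mono powr_mono2')
          then have "ennreal ((1 - ln t) powr (- 1 / p) / t) \<le> ennreal ((2 ^ j) powr (- 1 / p)) * ennreal (1 / t)"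
            using u by (subst ennreal_mult[symmetric]) (auto intro: ennreal_leI)
          moreover have "epow (\<Psi> t) (1 / p) \<le> epow (\<Psi> (tcut j)) (1 / p)"
            using t p by (intro epow_mono \<Psi>_mono) auto
          ultimately have "g t \<le> ennreal ((2 ^ j) powr (- 1 / p)) * ennreal (1 / t) * epow (\<Psi> (tcut j)) (1 / p)"
            unfolding g_def by (rule mult_mono) auto
          then show ?thesis using True \<open>j < m\<close> by (simp add: d_def mult_ac)
        qed simp
      qed
      also have "\<dots> \<le> (\<Sum>j. epow (\<Sum>k. ennreal ((2 powr - (p - 1)) ^ ((j - k) + (k - j))) * ?X k) (1 / p))"
        unfolding ln_tcut_diff
      proof (intro suminf_le)
        fix j
        show "d j * ennreal (2 ^ j) \<le> epow (\<Sum>k. ennreal ((2 powr - (p - 1)) ^ ((j - k) + (k - j))) * ?X k) (1 / p)"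
          unfolding d_def \<Psi>_def using small_integral_tail_term[OF F p, of j m] by auto
      qed auto
      also have "\<dots> \<le> ennreal C * (\<Sum>k. epow (?X k) (1 / p))" by (rule C(2))
      also have "(\<Sum>k. epow (?X k) (1 / p)) = (\<Sum>k\<le>m. epow (?X k) (1 / p))"
        by (intro suminf_finite) auto
      also have "\<dots> = (\<Sum>k\<le>m. ennreal (4 powr (1 / p)) * (ennreal (2 ^ k) * epow (wint F (tcut k)) (1 / p)))"
      proof (intro sum.cong refl)
        fix k assume "k \<in> {..m}"
        have "epow (ennreal (4 * (2 ^ k) powr p)) (1 / p) = ennreal (4 powr (1 / p)) * ennreal (2 ^ k)"
          using p by (subst epow_ennreal) (auto simp: powr_mult powr_powr ennreal_mult simp del: ennreal_power)
        then show "epow (?X k) (1 / p) = ennreal (4 powr (1 / p)) * (ennreal (2 ^ k) * epow (wint F (tcut k)) (1 / p))"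
          using \<open>k \<in> {..m}\<close> p by (simp add: epow_mult mult.assoc del: ennreal_power)
      qed
      also have "\<dots> = ennreal (4 powr (1 / p)) * ?S" by (simp add: sum_distrib_left)
      finally show ?thesis using C(1) by (simp add: ennreal_mult mult.assoc)
    qed
    finally show ?thesis
      using p C(1) by (simp add: distrib_right add_left_mono add_right_mono)
  qed
  moreover have "0 < p * 4 powr (1 / p) + C * 4 powr (1 / p)"
    using p C(1) by (intro add_pos_pos mult_pos_pos) auto
  ultimately show ?thesis by (rule that[rotated])
qed

section \<open>The K-functional from above\<close>

context fin_measure_domain
begin

abbreviation profile_wint :: "('a \<Rightarrow> real) \<Rightarrow> real \<Rightarrow> real \<Rightarrow> ennreal" where
  "profile_wint f p t \<equiv> wint (\<lambda>x. drearr \<Omega> f x powr p) t"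

text \<open>Where |g| exceeds a positive e, |f| exceeds its rearrangement at \<open>t0\<close> by
  more than e, and this happens on a set of measure at most \<open>t0\<close>. Hence every e > 0 is
  an admissible level for \<open>g\<close> at \<open>t\<close>.\<close>

lemma drearr_excess_eq_0:
  assumes f: "meas_on \<Omega> f" and g: "meas_on \<Omega> g" and t: "0 < t0" "t0 \<le> t"
    and gf: "\<And>x s. x \<in> \<Omega> \<Longrightarrow> 0 < s \<Longrightarrow> s < \<bar>g x\<bar> \<Longrightarrow> drearr \<Omega> f t0 + s < \<bar>f x\<bar>"
  shows "drearr \<Omega> g t = 0"
proof (rule antisym)
  show "drearr \<Omega> g t \<le> 0"
  proof (rule field_le_epsilon)
    fix e :: real assume e: "0 < e"
    have "distr_fun \<Omega> g e \<le> distr_fun \<Omega> f (drearr \<Omega> f t0 + e)"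
      using e gf by (intro distr_fun_mono f) auto
    also have "\<dots> \<le> ennreal t0" using e t by (intro distr_fun_above f) auto
    also have "\<dots> \<le> ennreal t" using t by (intro ennreal_leI) auto
    finally show "drearr \<Omega> g t \<le> 0 + e" using e by (simp add: drearr_le)
  qed
qed (use g t in \<open>auto intro: drearr_nonneg\<close>)

text \<open>The factor \<open>inverse (1 - ln t)\<close> is moved under the integral, where x \<ge>
  t allows replacing it by \<open>inverse (1 - ln x)\<close>. As the rearrangement of
  \<open>g\<close> vanishes from \<open>t0\<close> on, every member of the supremum is bounded by
  the same weighted integral, with constant 1.\<close>

lemma grand_norm_excess_le:
  assumes f: "meas_on \<Omega> f" and g: "meas_on \<Omega> g" and p: "0 < p" and t0: "0 < t0"
    and le: "\<And>t. 0 < t \<Longrightarrow> drearr \<Omega> g t \<le> drearr \<Omega> f t"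
    and vanish: "\<And>t. t0 \<le> t \<Longrightarrow> drearr \<Omega> g t = 0"
  shows "grand_norm \<Omega> p g \<le> epow (profile_wint f p t0) (1 / p)"
  unfolding grand_norm_def
proof (intro SUP_least)
  fix t :: real assume t: "t \<in> {0<..<1}"
  have [measurable]: "drearr \<Omega> g \<in> borel_measurable borel" by (rule drearr_measurable[OF g])
  have u: "1 \<le> 1 - ln t" using t by simp
  have "ennreal ((1 - ln t) powr (- 1 / p)) = epow (ennreal (inverse (1 - ln t))) (1 / p)"
    using powr_divide[of 1 "1 - ln t" "1 / p"] powr_minus_divide[of "1 - ln t" "1 / p"] u
    by (subst epow_ennreal) (auto simp: inverse_eq_divide)
  then have "ennreal ((1 - ln t) powr (- 1 / p)) * epow (\<integral>\<^sup>+x. indicator {t..1} x * ennreal (drearr \<Omega> g x powr p) \<partial>lborel) (1 / p)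
      = epow (ennreal (inverse (1 - ln t)) * (\<integral>\<^sup>+x. indicator {t..1} x * ennreal (drearr \<Omega> g x powr p) \<partial>lborel)) (1 / p)"
    using p by (simp add: epow_mult)
  also have "ennreal (inverse (1 - ln t)) * (\<integral>\<^sup>+x. indicator {t..1} x * ennreal (drearr \<Omega> g x powr p) \<partial>lborel)
      = (\<integral>\<^sup>+x. ennreal (inverse (1 - ln t)) * (indicator {t..1} x * ennreal (drearr \<Omega> g x powr p)) \<partial>lborel)"
    by (rule nn_integral_cmult[symmetric]) measurable
  also have "\<dots> \<le> profile_wint f p t0"
    unfolding wint_def
  proof (intro nn_integral_mono)
    fix x :: real
    show "ennreal (inverse (1 - ln t)) * (indicator {t..1} x * ennreal (drearr \<Omega> g x powr p)) \<le>
      indicator {0..t0} x * ennreal (drearr \<Omega> f x powr p * inverse (1 - ln x))"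
    proof (cases "t \<le> x \<and> x \<le> 1 \<and> x < t0")
      case True
      have "0 < x" using True t by auto
      then have lnx: "ln t \<le> ln x" "ln x \<le> 0" using True t by auto
      have "inverse (1 - ln t) \<le> inverse (1 - ln x)"
        using lnx by (intro le_imp_inverse_le) linarith+
      moreover have "drearr \<Omega> g x powr p \<le> drearr \<Omega> f x powr p"
        using \<open>0 < x\<close> p g by (intro powr_mono2 le drearr_nonneg) auto
      ultimately have "drearr \<Omega> g x powr p * inverse (1 - ln t) \<le> drearr \<Omega> f x powr p * inverse (1 - ln x)"
        using u by (intro mult_mono) auto
      then show ?thesis
        using True \<open>0 < x\<close> u ennreal_mult[of "drearr \<Omega> g x powr p" "inverse (1 - ln t)"]
        by (simp add: mult.commute[of "ennreal (inverse (1 - ln t))"] ennreal_leI flip: ennreal_mult)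
    qed (use vanish[of x] in \<open>auto simp: indicator_def\<close>)
  qed
  finally show "ennreal ((1 - ln t) powr (- 1 / p)) * epow (\<integral>\<^sup>+x. indicator {t..1} x * ennreal (drearr \<Omega> g x powr p) \<partial>lborel) (1 / p)
      \<le> epow (profile_wint f p t0) (1 / p)"
    using p by (simp add: epow_mono)
qed

lemma Kfun_le_wint:
  assumes p: "1 < p"
  obtains C where "0 < C"
    "\<And>f m. meas_on \<Omega> f \<Longrightarrow> Kfun \<Omega> p f (1 / 2 ^ m) \<le>
      ennreal C * (\<Sum>k\<le>m. ennreal (2 ^ k / 2 ^ m) * epow (profile_wint f p (tcut k)) (1 / p))"
proof -
  obtain C where C: "0 < C"
    "\<And>F G m. decreasing_profile F \<Longrightarrow> (\<And>x. 0 < x \<Longrightarrow> G x \<le> min (F x) (F (tcut m))) \<Longrightarrow>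
      (\<integral>\<^sup>+t. indicator {0<..<1} t * ennreal ((1 - ln t) powr (- 1 / p) / t) *
        epow (\<integral>\<^sup>+x. indicator {0..t} x * ennreal (G x) \<partial>lborel) (1 / p) \<partial>lborel)
      \<le> ennreal C * (\<Sum>k\<le>m. ennreal (2 ^ k) * epow (wint F (tcut k)) (1 / p))"
    using small_integral_truncated_le[OF p] by blast
  have "Kfun \<Omega> p f (1 / 2 ^ m) \<le> ennreal (1 + C) * (\<Sum>k\<le>m. ennreal (2 ^ k / 2 ^ m) * epow (profile_wint f p (tcut k)) (1 / p))"
    if f: "meas_on \<Omega> f" for f m
  proof -
    define h where "h k = epow (profile_wint f p (tcut k)) (1 / p)" for k
    define lv where "lv = drearr \<Omega> f (tcut m)"
    \<comment> \<open>Clamping to [-lv, lv] preserves the sign, so the excess \<open>g0\<close> has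
      absolute value max(|f| - lv, 0).\<close>
    define g1 where "g1 x = max (- lv) (min lv (f x))" for x
    define g0 where "g0 x = f x - g1 x" for x
    have lv: "0 \<le> lv" unfolding lv_def by (intro drearr_nonneg f) auto
    have [measurable]: "f \<in> borel_measurable (restrict_space lebesgue \<Omega>)"
      using f by (simp add: meas_on_def)
    have g1: "meas_on \<Omega> g1" unfolding meas_on_def g1_def by measurable
    then have g0: "meas_on \<Omega> g0" unfolding meas_on_def g0_def by measurable
    have bd: "\<bar>g1 x\<bar> \<le> \<bar>f x\<bar>" "\<bar>g1 x\<bar> \<le> lv" "\<bar>g0 x\<bar> \<le> \<bar>f x\<bar>" for x
      using lv by (auto simp: g0_def g1_def)
    have excess: "lv + s < \<bar>f x\<bar>" if "0 < s" "s < \<bar>g0 x\<bar>" for x s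
      using lv that by (auto simp: g0_def g1_def max_def min_def split: if_splits)
    have "grand_norm \<Omega> p g0 \<le> h m"
      unfolding h_def using p bd excess
      by (intro grand_norm_excess_le f g0 drearr_mono drearr_excess_eq_0[OF f g0, of "tcut m"]) (auto simp: lv_def)
    moreover have "h m = ennreal (2 ^ m / 2 ^ m) * h m" by simp
    moreover have "ennreal (2 ^ m / 2 ^ m) * h m \<le> (\<Sum>k\<le>m. ennreal (2 ^ k / 2 ^ m) * h k)"
      by (rule member_le_sum) auto
    ultimately have grand: "grand_norm \<Omega> p g0 \<le> (\<Sum>k\<le>m. ennreal (2 ^ k / 2 ^ m) * h k)" by (metis order_trans)
    have small: "small_norm \<Omega> p g1 \<le> ennreal C * (\<Sum>k\<le>m. ennreal (2 ^ k) * h k)"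
      unfolding small_norm_def h_def
    proof (rule C(2)[OF decreasing_profile_drearr[OF f]])
      fix x :: real assume x: "0 < x"
      have "drearr \<Omega> g1 x \<le> drearr \<Omega> f x" using bd by (intro drearr_mono f x)
      moreover have "{y \<in> \<Omega>. lv < \<bar>g1 y\<bar>} = {}" using bd(2) by (auto simp: not_less)
      then have "distr_fun \<Omega> g1 lv = 0" unfolding distr_fun_def by (simp only: emeasure_empty)
      then have "drearr \<Omega> g1 x \<le> lv" using lv by (intro drearr_le) auto
      ultimately show "drearr \<Omega> g1 x powr p \<le> min (drearr \<Omega> f x powr p) (drearr \<Omega> f (tcut m) powr p)"
        unfolding lv_def using x p g1 by (auto intro!: powr_mono2 drearr_nonneg)
    qed (use p in auto)
    have split: "ennreal (1 / 2 ^ m) * (\<Sum>k\<le>m. ennreal (2 ^ k) * h k) = (\<Sum>k\<le>m. ennreal (2 ^ k / 2 ^ m) * h k)"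
    proof -
      have "ennreal (2 ^ k / 2 ^ m) = ennreal (1 / 2 ^ m) * ennreal (2 ^ k)" for k
        by (subst ennreal_mult[symmetric]) auto
      then show ?thesis by (simp add: sum_distrib_left mult.assoc del: ennreal_power)
    qed
    show ?thesis
    \<comment> \<open>The pair (g0, g1) is admissible for the K-functional only if both norms are
      finite. A finite right-hand side ensures this; an infinite one makes the claim
      trivial.\<close>
    proof (cases "(\<Sum>k\<le>m. ennreal (2 ^ k / 2 ^ m) * h k) = top")
      case True
      then show ?thesis
        using C(1) unfolding h_def[symmetric] by (simp only: ennreal_mult_top) simp
    next
      case False
      then have "(\<Sum>k\<le>m. ennreal (2 ^ k) * h k) \<noteq> top"
        unfolding split[symmetric] by (auto simp: ennreal_mult_eq_top_iff)
      then have "small_norm \<Omega> p g1 < top"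
        by (intro le_less_trans[OF small]) (auto simp: ennreal_mult_less_top top.not_eq_extremum)
      moreover have "grand_norm \<Omega> p g0 < top"
        using grand False by (auto simp: top.not_eq_extremum intro: le_less_trans)
      ultimately have "Kfun \<Omega> p f (1 / 2 ^ m) \<le> grand_norm \<Omega> p (fst (g0, g1)) + ennreal (1 / 2 ^ m) * small_norm \<Omega> p (snd (g0, g1))"
        unfolding Kfun_def using g0 g1
        by (intro INF_lower) (auto simp: grand_space_def small_space_def g0_def)
      also have "\<dots> \<le> (\<Sum>k\<le>m. ennreal (2 ^ k / 2 ^ m) * h k) + ennreal (1 / 2 ^ m) * (ennreal C * (\<Sum>k\<le>m. ennreal (2 ^ k) * h k))"
        using grand small by (auto intro!: add_mono mult_left_mono)
      also have "\<dots> = ennreal (1 + C) * (\<Sum>k\<le>m. ennreal (2 ^ k / 2 ^ m) * h k)"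
        unfolding split[symmetric] using C(1) by (simp add: distrib_right mult_ac)
      finally show ?thesis unfolding h_def .
    qed
  qed
  then show ?thesis using that[of "1 + C"] C(1) by auto
qed

text \<open>For m = k + d the weight 2^(\<theta>m) times 2^(k-m) equals 2^(-(1-\<theta>)d) times
  2^(\<theta>k), a decaying kernel because \<theta> < 1. The Hardy inequality with exponent
  \<open>r\<close> applies, and the term h_0 that it leaves is removed by the shift.\<close>

lemma Kfun_series_le_wint_series:
  fixes p \<theta> r :: real
  assumes p: "1 < p" and \<theta>: "\<theta> < 1" and r: "0 < r"
  obtains C where "0 < C"
    "\<And>f. meas_on \<Omega> f \<Longrightarrow>
      (\<Sum>m. ennreal (2 powr (\<theta> * r * real m)) * epow (Kfun \<Omega> p f (1 / 2 ^ Suc m)) r) \<le>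
      ennreal C * (\<Sum>m. ennreal (2 powr (\<theta> * r * real m)) * epow (profile_wint f p (tcut (Suc m))) (r / p))"
proof -
  obtain C1 where C1: "0 < C1"
    "\<And>f m. meas_on \<Omega> f \<Longrightarrow> Kfun \<Omega> p f (1 / 2 ^ m) \<le>
      ennreal C1 * (\<Sum>k\<le>m. ennreal (2 ^ k / 2 ^ m) * epow (profile_wint f p (tcut k)) (1 / p))"
    using Kfun_le_wint[OF p] by blast
  let ?q = "2 powr - (1 - \<theta>)"
  have "0 < ?q" "?q < 1" using \<theta> by (auto simp: powr_less_one)
  from discrete_hardy[OF this r] obtain C2 where C2: "0 < C2"
    "\<And>X :: nat \<Rightarrow> ennreal. (\<Sum>m. epow (\<Sum>k. ennreal (?q ^ ((m - k) + (k - m))) * X k) r) \<le> ennreal C2 * (\<Sum>k. epow (X k) r)"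
    by blast
  define C where "C = C1 powr r * C2 * (25 powr (r / p) + 2 powr (\<theta> * r))"
  have "0 < 25 powr (r / p) + 2 powr (\<theta> * r)" by (intro add_pos_pos) auto
  then have "0 < C" using C1(1) C2(1) by (simp add: C_def)
  moreover have "(\<Sum>m. ennreal (2 powr (\<theta> * r * real m)) * epow (Kfun \<Omega> p f (1 / 2 ^ Suc m)) r) \<le>
      ennreal C * (\<Sum>m. ennreal (2 powr (\<theta> * r * real m)) * epow (profile_wint f p (tcut (Suc m))) (r / p))"
    (is "_ \<le> _ * ?D") if f: "meas_on \<Omega> f" for f
  proof -
    define h where "h k = epow (profile_wint f p (tcut k)) (1 / p)" for k
    define X where "X k = ennreal (2 powr (\<theta> * real k)) * h k" for k
    have coeff: "2 powr (\<theta> * real m) * (2 ^ k / 2 ^ m) = ?q ^ ((m - k) + (k - m)) * 2 powr (\<theta> * real k)" if km: "k \<le> m" for k m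
    proof -
      from le_Suc_ex[OF km] obtain d where m: "m = k + d" by blast
      have "2 powr (\<theta> * real m) * (2 ^ k / 2 ^ m) = 2 powr (\<theta> * real k) * (2 powr (\<theta> * real d) * (1 / 2 ^ d))"
        by (simp add: m algebra_simps powr_add power_add)
      also have "1 / 2 ^ d = (2 powr - real d :: real)"
        by (simp add: powr_minus powr_realpow inverse_eq_divide)
      also have "2 powr (\<theta> * real d) * 2 powr - real d = ?q ^ d"
        by (subst powr_power) (auto simp: algebra_simps simp flip: powr_add)
      finally show ?thesis by (simp add: m mult.commute)
    qed
    have X_pow: "epow (X k) r = ennreal (2 powr (\<theta> * r * real k)) * epow (profile_wint f p (tcut k)) (r / p)" for k
      using r p by (simp add: X_def h_def epow_mult epow_epow epow_ennreal powr_powr mult_ac)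
    have step: "ennreal (2 powr (\<theta> * r * real m)) * epow (Kfun \<Omega> p f (1 / 2 ^ Suc m)) r \<le>
        ennreal (C1 powr r) * epow (\<Sum>k. ennreal (?q ^ ((m - k) + (k - m))) * X k) r" for m
    proof -
      \<comment> \<open>The K-functional at \<open>1 / 2 ^ Suc m\<close> is first enlarged to its
        value at \<open>1 / 2 ^ m\<close>, so that the sum ends at the index of the weight.\<close>
      have "ennreal (2 powr (\<theta> * real m)) * Kfun \<Omega> p f (1 / 2 ^ Suc m) \<le>
          ennreal (2 powr (\<theta> * real m)) * (ennreal C1 * (\<Sum>k\<le>m. ennreal (2 ^ k / 2 ^ m) * h k))"
        unfolding h_def
        by (intro mult_left_mono order_trans[OF Kfun_mono C1(2)[OF f]]) (auto simp: field_simps)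
      also have "\<dots> = ennreal C1 * (\<Sum>k\<le>m. ennreal (2 powr (\<theta> * real m)) * (ennreal (2 ^ k / 2 ^ m) * h k))"
        by (simp only: sum_distrib_left mult.left_commute)
      also have "(\<Sum>k\<le>m. ennreal (2 powr (\<theta> * real m)) * (ennreal (2 ^ k / 2 ^ m) * h k)) =
          (\<Sum>k\<le>m. ennreal (?q ^ ((m - k) + (k - m))) * X k)"
      proof (intro sum.cong refl)
        fix k assume "k \<in> {..m}"
        then have "ennreal (2 powr (\<theta> * real m)) * ennreal (2 ^ k / 2 ^ m) = ennreal (?q ^ ((m - k) + (k - m))) * ennreal (2 powr (\<theta> * real k))"
          using coeff[of k m] by (subst (1 2) ennreal_mult[symmetric]) auto
        then show "ennreal (2 powr (\<theta> * real m)) * (ennreal (2 ^ k / 2 ^ m) * h k) = ennreal (?q ^ ((m - k) + (k - m))) * X k"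
          unfolding X_def by (metis mult.assoc)
      qed
      also have "ennreal C1 * \<dots> \<le> ennreal C1 * (\<Sum>k. ennreal (?q ^ ((m - k) + (k - m))) * X k)"
        by (intro mult_left_mono sum_le_suminf) auto
      finally have "epow (ennreal (2 powr (\<theta> * real m)) * Kfun \<Omega> p f (1 / 2 ^ Suc m)) r \<le>
          epow (ennreal C1 * (\<Sum>k. ennreal (?q ^ ((m - k) + (k - m))) * X k)) r"
        using r by (intro epow_mono) auto
      then show ?thesis
        using r C1(1) by (simp add: epow_mult epow_ennreal powr_powr mult_ac)
    qed
    have "(\<Sum>m. ennreal (2 powr (\<theta> * r * real m)) * epow (Kfun \<Omega> p f (1 / 2 ^ Suc m)) r) \<le>
        (\<Sum>m. ennreal (C1 powr r) * epow (\<Sum>k. ennreal (?q ^ ((m - k) + (k - m))) * X k) r)"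
      by (intro suminf_le step) auto
    also have "\<dots> = ennreal (C1 powr r) * (\<Sum>m. epow (\<Sum>k. ennreal (?q ^ ((m - k) + (k - m))) * X k) r)"
      by (rule ennreal_suminf_cmult)
    also have "\<dots> \<le> ennreal (C1 powr r) * (ennreal C2 * (\<Sum>k. epow (X k) r))"
      by (intro mult_left_mono C2(2)) auto
    also have "(\<Sum>k. epow (X k) r) \<le> ennreal (25 powr (r / p) + 2 powr (\<theta> * r)) * ?D"
      unfolding X_pow using p r by (intro suminf_shift_discrete decreasing_profile_drearr f) auto
    also have "ennreal (C1 powr r) * (ennreal C2 * (ennreal (25 powr (r / p) + 2 powr (\<theta> * r)) * ?D)) = ennreal C * ?D"
      using C2(1) by (simp add: C_def ennreal_mult mult.assoc del: ennreal_plus)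
    finally show ?thesis by (simp add: mult_left_mono)
  qed
  ultimately show ?thesis by (rule that)
qed

text \<open>Blocks add up before the p-th root is taken, so the Hardy inequality is used with
  exponent \<open>r / p\<close> on the block integrals themselves. The weight 2^(\<theta>pm) is
  2^(-\<theta>p(k-m)) times 2^(\<theta>pk), which decays in k - m because \<theta> > 0.\<close>

lemma wint_series_le_Kfun_series:
  fixes p \<theta> r :: real
  assumes p: "1 < p" and \<theta>: "0 < \<theta>" and r: "0 < r"
  obtains C where "0 < C"
    "\<And>f. meas_on \<Omega> f \<Longrightarrow>
      (\<Sum>m. ennreal (2 powr (\<theta> * r * real m)) * epow (profile_wint f p (tcut (Suc m))) (r / p)) \<le>
      ennreal C * (\<Sum>m. ennreal (2 powr (\<theta> * r * real m)) * epow (Kfun \<Omega> p f (1 / 2 ^ Suc m)) r)"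
proof -
  let ?c = "(2 powr p * 2 * (4 + 2 powr p)) powr (1 / p)"
  let ?q = "2 powr - (\<theta> * p)"
  have "0 < ?q" "?q < 1" "0 < r / p" using \<theta> p r by (auto simp: powr_less_one)
  from discrete_hardy[OF this] obtain C2 where C2: "0 < C2"
    "\<And>X :: nat \<Rightarrow> ennreal. (\<Sum>m. epow (\<Sum>k. ennreal (?q ^ ((m - k) + (k - m))) * X k) (r / p)) \<le> ennreal C2 * (\<Sum>k. epow (X k) (r / p))"
    by blast
  have "0 < 4 + 2 powr p" by (intro add_pos_nonneg) auto
  then have "0 < C2 * ?c powr r" using C2 by auto
  moreover have "(\<Sum>m. ennreal (2 powr (\<theta> * r * real m)) * epow (profile_wint f p (tcut (Suc m))) (r / p)) \<le>
      ennreal (C2 * ?c powr r) * (\<Sum>m. ennreal (2 powr (\<theta> * r * real m)) * epow (Kfun \<Omega> p f (1 / 2 ^ Suc m)) r)"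
    (is "_ \<le> _ * ?L") if f: "meas_on \<Omega> f" for f
  proof -
    interpret F: decreasing_profile "\<lambda>x. drearr \<Omega> f x powr p"
      using p by (intro decreasing_profile_drearr f) auto
    define b where "b k = (\<integral>\<^sup>+x. indicator {tcut (Suc k)..<tcut k} x * ennreal (drearr \<Omega> f x powr p * inverse (1 - ln x)) \<partial>lborel)" for k
    define X where "X k = ennreal (2 powr (\<theta> * p * real k)) * b (Suc k)" for k
    have X_pow: "epow (X k) (r / p) \<le> ennreal (?c powr r) * (ennreal (2 powr (\<theta> * r * real k)) * epow (Kfun \<Omega> p f (1 / 2 ^ Suc k)) r)" for k
    proof -
      have "epow (b (Suc k)) (1 / p) \<le> ennreal ?c * Kfun \<Omega> p f (1 / 2 ^ Suc k)"
        unfolding b_def by (rule block_le_Kfun[OF f p])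
      then have "epow (epow (b (Suc k)) (1 / p)) r \<le> epow (ennreal ?c * Kfun \<Omega> p f (1 / 2 ^ Suc k)) r"
        using r by (intro epow_mono) auto
      then have "epow (b (Suc k)) (r / p) \<le> ennreal (?c powr r) * epow (Kfun \<Omega> p f (1 / 2 ^ Suc k)) r"
        using r p epow_ennreal[of ?c r] by (simp add: epow_epow epow_mult)
      then have "ennreal (2 powr (\<theta> * r * real k)) * epow (b (Suc k)) (r / p) \<le>
          ennreal (2 powr (\<theta> * r * real k)) * (ennreal (?c powr r) * epow (Kfun \<Omega> p f (1 / 2 ^ Suc k)) r)"
        by (rule mult_left_mono) simp
      moreover have "epow (X k) (r / p) = ennreal (2 powr (\<theta> * r * real k)) * epow (b (Suc k)) (r / p)"
        unfolding X_def using r p by (simp add: epow_mult epow_ennreal powr_powr mult_ac)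
      ultimately show ?thesis by (simp only: mult.left_commute)
    qed
    have step: "ennreal (2 powr (\<theta> * r * real m)) * epow (profile_wint f p (tcut (Suc m))) (r / p) \<le>
        epow (\<Sum>k. ennreal (?q ^ ((m - k) + (k - m))) * X k) (r / p)" for m
    proof -
      have "profile_wint f p (tcut (Suc m)) \<le> (\<Sum>k. if Suc m \<le> k then b k else 0)"
        unfolding b_def by (rule F.wint_tcut_le_blocks)
      \<comment> \<open>The term \<open>k = 0\<close> is zero; dropping it aligns block
        \<open>Suc k\<close> with the K-functional at \<open>1 / 2 ^ Suc k\<close>.\<close>
      also have "\<dots> = (\<Sum>k. if Suc m \<le> k + 1 then b (k + 1) else 0) + (\<Sum>k<1. if Suc m \<le> k then b k else 0)"
        by (rule suminf_offset) simp
      also have "\<dots> = (\<Sum>k. if m \<le> k then b (Suc k) else 0)"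
        unfolding Suc_eq_plus1 by simp
      finally have "ennreal (2 powr (\<theta> * p * real m)) * profile_wint f p (tcut (Suc m)) \<le>
          ennreal (2 powr (\<theta> * p * real m)) * (\<Sum>k. if m \<le> k then b (Suc k) else 0)"
        by (rule mult_left_mono) simp
      also have "\<dots> = (\<Sum>k. ennreal (2 powr (\<theta> * p * real m)) * (if m \<le> k then b (Suc k) else 0))"
        by (rule ennreal_suminf_cmult[symmetric])
      also have "\<dots> \<le> (\<Sum>k. ennreal (?q ^ ((m - k) + (k - m))) * X k)"
      proof (intro suminf_le)
        fix k
        show "ennreal (2 powr (\<theta> * p * real m)) * (if m \<le> k then b (Suc k) else 0) \<le> ennreal (?q ^ ((m - k) + (k - m))) * X k"
        proof (cases "m \<le> k")
          case True
          from le_Suc_ex[OF this] obtain d where k: "k = m + d" by blast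
          have "?q ^ d * 2 powr (\<theta> * p * real k) = 2 powr (\<theta> * p * real m)"
            by (subst powr_power) (auto simp: k algebra_simps simp flip: powr_add)
          then have "ennreal (2 powr (\<theta> * p * real m)) = ennreal (?q ^ ((m - k) + (k - m))) * ennreal (2 powr (\<theta> * p * real k))"
            by (subst ennreal_mult[symmetric]) (auto simp: k)
          then show ?thesis using True by (simp only: X_def mult.assoc if_True order_refl)
        qed simp
      qed auto
      finally have "epow (ennreal (2 powr (\<theta> * p * real m)) * profile_wint f p (tcut (Suc m))) (r / p) \<le>
          epow (\<Sum>k. ennreal (?q ^ ((m - k) + (k - m))) * X k) (r / p)"
        using r p by (intro epow_mono) auto
      then show ?thesis using r p by (simp add: epow_mult epow_ennreal powr_powr mult_ac)
    qed
    have "(\<Sum>m. ennreal (2 powr (\<theta> * r * real m)) * epow (profile_wint f p (tcut (Suc m))) (r / p)) \<le>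
        (\<Sum>m. epow (\<Sum>k. ennreal (?q ^ ((m - k) + (k - m))) * X k) (r / p))"
      by (intro suminf_le step) auto
    also have "\<dots> \<le> ennreal C2 * (\<Sum>k. epow (X k) (r / p))" by (rule C2(2))
    also have "\<dots> \<le> ennreal C2 * (\<Sum>k. ennreal (?c powr r) * (ennreal (2 powr (\<theta> * r * real k)) * epow (Kfun \<Omega> p f (1 / 2 ^ Suc k)) r))"
      by (intro mult_left_mono suminf_le X_pow) auto
    also have "\<dots> = ennreal C2 * (ennreal (?c powr r) * ?L)"
      by (subst ennreal_suminf_cmult) simp
    also have "\<dots> = ennreal (C2 * ?c powr r) * ?L"
      using ennreal_mult[of C2 "?c powr r"] C2(1) by (simp add: mult.assoc)
    finally show ?thesis .
  qed
  ultimately show ?thesis by (rule that)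
qed

end

section \<open>Equality of the spaces and equivalence of the norms\<close>

theorem theorem1p3:
  fixes \<Omega> :: "'a::euclidean_space set" and p \<theta> r :: real
  assumes "open \<Omega>" and "bounded \<Omega>" and "emeasure lebesgue \<Omega> = 1"
    and "1 < p" and "0 < \<theta>" and "\<theta> < 1" and "1 \<le> r"
  defines "w1 \<equiv> (\<lambda>t::real. inverse t * (1 - ln t) powr (\<theta> * r - 1))"
    and "w2 \<equiv> (\<lambda>t::real. inverse (1 - ln t))"
  shows "interp_space \<Omega> p \<theta> r = ggamma_space \<Omega> p r w1 w2 \<and>
    (\<exists>C>0. \<forall>f \<in> interp_space \<Omega> p \<theta> r.
        ggamma_norm \<Omega> p r w1 w2 f \<le> ennreal C * interp_norm \<Omega> p \<theta> r f \<and>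
        interp_norm \<Omega> p \<theta> r f \<le> ennreal C * ggamma_norm \<Omega> p r w1 w2 f)"
proof -
  interpret fin_measure_domain \<Omega>
    using assms(1,3) by unfold_locales auto
  have r: "0 < r" and p: "0 < p" and rp: "0 < r / p" using assms by auto
  define I where "I f = (\<integral>\<^sup>+t. indicator {0<..<1} t * epow (ennreal (t powr - \<theta>) * Kfun \<Omega> p f t) r * ennreal (1 / t) \<partial>lborel)" for f
  define R where "R f = (\<integral>\<^sup>+t. indicator {0<..<1} t * ennreal (inverse t * (1 - ln t) powr (\<theta> * r - 1)) * epow (profile_wint f p t) (r / p) \<partial>lborel)" for f
  define L where "L f = (\<Sum>m. ennreal (2 powr (\<theta> * r * real m)) * epow (Kfun \<Omega> p f (1 / 2 ^ Suc m)) r)" for f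
  define D where "D f = (\<Sum>m. ennreal (2 powr (\<theta> * r * real m)) * epow (profile_wint f p (tcut (Suc m))) (r / p))" for f
  have interp: "interp_norm \<Omega> p \<theta> r f = epow (I f) (1 / r)" for f
    by (simp add: interp_norm_def I_def)
  have ggamma: "ggamma_norm \<Omega> p r w1 w2 f = epow (R f) (1 / r)" for f
    by (simp add: ggamma_norm_def R_def wint_def w1_def w2_def)
  have IL: "I f \<le> ennreal (2 powr (\<theta> * r + r)) * L f" and LI: "L f \<le> ennreal 2 * I f" for f
    unfolding I_def L_def by (rule nn_integral_Kfun_equiv[OF assms(5) r])+
  obtain C1 where C1: "0 < C1" and RD: "\<And>f. meas_on \<Omega> f \<Longrightarrow> R f \<le> ennreal C1 * D f"
    and DR: "\<And>f. meas_on \<Omega> f \<Longrightarrow> D f \<le> ennreal C1 * R f"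
  proof (rule nn_integral_wint_equiv[OF rp, of "\<theta> * r"], goal_cases)
    case (1 C)
    show ?case
      by (rule 1(1)[of C]; (unfold R_def D_def)?; (intro 1 decreasing_profile_drearr p)?)
  qed
  obtain C2 where C2: "0 < C2" and LD: "\<And>f. meas_on \<Omega> f \<Longrightarrow> L f \<le> ennreal C2 * D f"
    unfolding L_def D_def using Kfun_series_le_wint_series[OF assms(4,6) r] by blast
  obtain C3 where C3: "0 < C3" and DL: "\<And>f. meas_on \<Omega> f \<Longrightarrow> D f \<le> ennreal C3 * L f"
    unfolding L_def D_def using wint_series_le_Kfun_series[OF assms(4,5) r] by blast
  \<comment> \<open>The two entries are the products of constants along I \<le> L \<le> D \<le> R
    and R \<le> D \<le> L \<le> I.\<close>
  define c where "c = max (2 powr (\<theta> * r + r) * (C2 * C1)) (C1 * (C3 * 2))"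
  have c: "0 < c" using C1 by (auto simp: c_def less_max_iff_disj C3)
  have IR: "I f \<le> ennreal c * R f" if f: "meas_on \<Omega> f" for f
  proof -
    have "I f \<le> ennreal (2 powr (\<theta> * r + r)) * (ennreal C2 * (ennreal C1 * R f))"
      by (intro order_trans[OF IL] mult_left_mono order_trans[OF LD] DR f) auto
    also have "\<dots> = ennreal (2 powr (\<theta> * r + r) * (C2 * C1)) * R f"
      using C1 C2 by (simp add: ennreal_mult mult.assoc)
    also have "\<dots> \<le> ennreal c * R f"
      by (intro mult_right_mono ennreal_leI) (auto simp: c_def)
    finally show ?thesis .
  qed
  have RI: "R f \<le> ennreal c * I f" if f: "meas_on \<Omega> f" for f
  proof -
    have "R f \<le> ennreal C1 * (ennreal C3 * (ennreal 2 * I f))"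
      by (intro order_trans[OF RD] mult_left_mono order_trans[OF DL] LI f) auto
    also have "\<dots> = ennreal (C1 * (C3 * 2)) * I f"
      using C1 C3 by (simp add: ennreal_mult mult.assoc flip: ennreal_numeral)
    also have "\<dots> \<le> ennreal c * I f"
      by (intro mult_right_mono ennreal_leI) (auto simp: c_def)
    finally show ?thesis .
  qed
  \<comment> \<open>An infimum over no decompositions is \<open>top\<close>, so finiteness of the
    K-functional at one point already yields a decomposition. The point 1/2 carries the first term
    of the series.\<close>
  have sum_space: "f \<in> sum_space \<Omega> p" if f: "meas_on \<Omega> f" and fin: "I f < top" for f
  proof -
    have "epow (Kfun \<Omega> p f (1 / 2)) r = (\<Sum>m\<in>{0}. ennreal (2 powr (\<theta> * r * real m)) * epow (Kfun \<Omega> p f (1 / 2 ^ Suc m)) r)"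
      by simp
    also have "\<dots> \<le> L f" unfolding L_def by (rule sum_le_suminf) auto
    also have "\<dots> \<le> ennreal 2 * I f" by (rule LI)
    also have "\<dots> < top" using fin by (simp add: ennreal_mult_less_top)
    finally have "Kfun \<Omega> p f (1 / 2) < top" by (simp add: epow_less_top_iff)
    then have "\<exists>g0 g1. g0 \<in> grand_space \<Omega> p \<and> g1 \<in> small_space \<Omega> p \<and> (\<forall>x\<in>\<Omega>. f x = g0 x + g1 x)"
      unfolding Kfun_def by (auto simp: INF_less_iff)
    with f show ?thesis by (auto simp: sum_space_def)
  qed
  have norm_le: "epow A (1 / r) \<le> ennreal (c powr (1 / r)) * epow B (1 / r)" if "A \<le> ennreal c * B" for A B
    using epow_mono[OF _ that, of "1 / r"] r c by (simp add: epow_mult epow_ennreal)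
  have meas: "meas_on \<Omega> f" if "f \<in> interp_space \<Omega> p \<theta> r" for f
    using that by (simp add: interp_space_def sum_space_def)
  have "interp_space \<Omega> p \<theta> r = ggamma_space \<Omega> p r w1 w2"
  proof (intro set_eqI iffI)
    fix f assume f: "f \<in> interp_space \<Omega> p \<theta> r"
    then have "I f < top" by (simp add: interp_space_def interp epow_less_top_iff)
    then have "R f < top" by (intro le_less_trans[OF RI[OF meas[OF f]]]) (simp add: ennreal_mult_less_top)
    then show "f \<in> ggamma_space \<Omega> p r w1 w2"
      using meas[OF f] by (simp add: ggamma_space_def ggamma epow_less_top_iff)
  next
    fix f assume "f \<in> ggamma_space \<Omega> p r w1 w2"
    then have f: "meas_on \<Omega> f" "R f < top" by (simp_all add: ggamma_space_def ggamma epow_less_top_iff)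
    then have "I f < top" by (intro le_less_trans[OF IR[OF f(1)]]) (simp add: ennreal_mult_less_top)
    then show "f \<in> interp_space \<Omega> p \<theta> r"
      using sum_space f by (simp add: interp_space_def interp epow_less_top_iff)
  qed
  moreover have "\<exists>C>0. \<forall>f \<in> interp_space \<Omega> p \<theta> r.
        ggamma_norm \<Omega> p r w1 w2 f \<le> ennreal C * interp_norm \<Omega> p \<theta> r f \<and>
        interp_norm \<Omega> p \<theta> r f \<le> ennreal C * ggamma_norm \<Omega> p r w1 w2 f"
    unfolding interp ggamma using c
    by (intro exI[of _ "c powr (1 / r)"] conjI ballI norm_le IR RI meas) auto
  ultimately show ?thesis by blast
qed

end
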